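(* Let $G=(V,E)$ be a connected locally finite graph which is transient for simple random walk. Then there does not exist an irreducible transient Markov chain $\mathbf{X}$ with $G(\mathbf{X})=G$ which with positive probability crosses each edge of $G$ (in at least one direction) at least once. In fact, there does not exist an irreducible transient Markov chain $\mathbf{X}$ on a countable state space, admitting a stationary measure, such that $G$ is a subgraph of $G(\mathbf{X})$, which with positive probability crosses every edge of $E$ (in at least one direction) at least once.
   Context: Graphs are undirected and may contain loops; locally finite means every vertex has finite degree. Simple random walk on $G$ moves from $x$ to a uniformly chosen neighbour of $x$. For an irreducible Markov chain $\mathbf{X}=(X_n)_{n\ge 0}$ with transition kernel $P$ on a countable state space $U$, $G(\mathbf X)$ is the undirected graph with vertex set $U$ and edge set $\{\{u,v\}:P(u,v)+P(v,u)>0\}$. The chain need not be reversible, and is started from a fixed initial state. The chain crosses the edge $\{x,y\}$ if $\{X_n,X_{n+1}\}=\{x,y\}$ for some $n\ge 0$. The chain is recurrent if its initial state is visited infinitely often a.s., and transient otherwise. A stationary measure is a measure $\pi$ with $0<\pi(x)<\infty$ for all $x$ and $\pi P=\pi$ (total mass possibly infinite). *)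

theory Defs
  imports "HOL-Probability.Probability"
begin

text \<open>
  An undirected graph is a pair of a vertex set and a set of edges \<open>{u, v}\<close>; a loop at \<open>u\<close>
  is the edge \<open>{u, u} = {u}\<close>.
\<close>

type_synonym 'a ugraph = "'a set \<times> 'a set set"

definition ugraph :: "'a ugraph \<Rightarrow> bool" where
  "ugraph G \<longleftrightarrow> snd G \<subseteq> {{u, v} | u v. u \<in> fst G \<and> v \<in> fst G}"

definition subgraph :: "'a ugraph \<Rightarrow> 'a ugraph \<Rightarrow> bool" where
  "subgraph G H \<longleftrightarrow> fst G \<subseteq> fst H \<and> snd G \<subseteq> snd H"

definition neighbours :: "'a ugraph \<Rightarrow> 'a \<Rightarrow> 'a set" where
  "neighbours G x = {y. {x, y} \<in> snd G}"

definition locally_finite_graph :: "'a ugraph \<Rightarrow> bool" where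
  "locally_finite_graph G \<longleftrightarrow> (\<forall>x \<in> fst G. finite (neighbours G x))"

definition connected_graph :: "'a ugraph \<Rightarrow> bool" where
  "connected_graph G \<longleftrightarrow>
     (\<forall>x \<in> fst G. \<forall>y \<in> fst G. (x, y) \<in> {(u, v). {u, v} \<in> snd G}\<^sup>*)"

text \<open>
  A Markov chain \<open>X\<close> on the countable state space \<open>U\<close>, started at \<open>x0\<close>, with transition
  probabilities \<open>P(x, y) = pmf (P x) y\<close>. Only the values of \<open>P\<close> on \<open>U\<close> matter. The last
  assumption is the Markov property, in multiplied-out form so that conditioning events of
  probability zero need no separate treatment.
\<close>

locale markov_chain = prob_space M
  for M :: "'m measure" +
  fixes U :: "'a set" and P :: "'a \<Rightarrow> 'a pmf" and x0 :: 'a and X :: "nat \<Rightarrow> 'm \<Rightarrow> 'a"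
  assumes countable_states: "countable U"
    and kernel_closed: "\<And>x. x \<in> U \<Longrightarrow> set_pmf (P x) \<subseteq> U"
    and initial_state: "x0 \<in> U"
    and measurable_step: "\<And>n. X n \<in> measurable M (count_space U)"
    and start: "AE \<omega> in M. X 0 \<omega> = x0"
    and markov_property: "\<And>n xs.
      measure M {\<omega> \<in> space M. \<forall>i \<le> Suc n. X i \<omega> = xs i} =
      measure M {\<omega> \<in> space M. \<forall>i \<le> n. X i \<omega> = xs i} * pmf (P (xs n)) (xs (Suc n))"

primrec kernel_power :: "('a \<Rightarrow> 'a pmf) \<Rightarrow> nat \<Rightarrow> 'a \<Rightarrow> 'a pmf" where
  "kernel_power P 0 x = return_pmf x"
| "kernel_power P (Suc n) x = bind_pmf (kernel_power P n x) P"

definition irreducible_kernel :: "'a set \<Rightarrow> ('a \<Rightarrow> 'a pmf) \<Rightarrow> bool" where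
  "irreducible_kernel U P \<longleftrightarrow> (\<forall>x \<in> U. \<forall>y \<in> U. \<exists>n. pmf (kernel_power P n x) y > 0)"

definition recurrent_chain :: "'m measure \<Rightarrow> 'a \<Rightarrow> (nat \<Rightarrow> 'm \<Rightarrow> 'a) \<Rightarrow> bool" where
  "recurrent_chain M x0 X \<longleftrightarrow> (AE \<omega> in M. infinite {n. X n \<omega> = x0})"

abbreviation transient_chain :: "'m measure \<Rightarrow> 'a \<Rightarrow> (nat \<Rightarrow> 'm \<Rightarrow> 'a) \<Rightarrow> bool" where
  "transient_chain M x0 X \<equiv> \<not> recurrent_chain M x0 X"

definition chain_graph :: "'a set \<Rightarrow> ('a \<Rightarrow> 'a pmf) \<Rightarrow> 'a ugraph" where
  "chain_graph U P =
     (U, {{u, v} | u v. u \<in> U \<and> v \<in> U \<and> pmf (P u) v + pmf (P v) u > 0})"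

definition stationary_measure :: "'a set \<Rightarrow> ('a \<Rightarrow> 'a pmf) \<Rightarrow> ('a \<Rightarrow> real) \<Rightarrow> bool" where
  "stationary_measure U P \<pi> \<longleftrightarrow>
     (\<forall>x \<in> U. \<pi> x > 0) \<and> (\<forall>y \<in> U. ((\<lambda>x. \<pi> x * pmf (P x) y) has_sum \<pi> y) U)"

definition crosses_edge :: "(nat \<Rightarrow> 'm \<Rightarrow> 'a) \<Rightarrow> 'm \<Rightarrow> 'a set \<Rightarrow> bool" where
  "crosses_edge X \<omega> e \<longleftrightarrow> (\<exists>n. {X n \<omega>, X (Suc n) \<omega>} = e)"

text \<open>
  Simple random walk. The value at a vertex without neighbours (where there is nowhere to go)
  is a convention: the walk stays put, so that the one-vertex graph without edges is recurrent.
\<close>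

definition srw_kernel :: "'a ugraph \<Rightarrow> 'a \<Rightarrow> 'a pmf" where
  "srw_kernel G x =
     (if neighbours G x = {} then return_pmf x else pmf_of_set (neighbours G x))"

text \<open>
  The law of a chain is determined by its kernel and its initial state, and it can always be
  realised on path space; hence it is no restriction that the probability space below is
  one on sequences of vertices. For connected graphs the choice of the initial vertex
  is immaterial as well.
\<close>

definition srw_transient :: "'a ugraph \<Rightarrow> bool" where
  "srw_transient G \<longleftrightarrow>
     (\<exists>x0 \<in> fst G. \<exists>(N :: (nat \<Rightarrow> 'a) measure) Y.
        markov_chain N (fst G) (srw_kernel G) x0 Y \<and> transient_chain N x0 Y)"

end

theory Submission imports Defs
begin

text \<open>
  Why the theorem holds. Let \<open>X\<close> be transient, started at \<open>x0\<close>, and let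
  \<open>h x = green P x x0\<close> be the expected number of visits to \<open>x0\<close> from \<open>x\<close>. Then \<open>h\<close>
  is superharmonic, it is positive by irreducibility, and \<open>E h(X n) \<longlonglongrightarrow> 0\<close>. The truncations
  \<open>Z = min 1 (k * h)\<close> are superharmonic with values in \<open>[0, 1]\<close>, and a bounded supermartingale
  has bounded quadratic variation, so \<open>E (\<Sum>n. (Z (X n) - Z (X (n+1)))\<^sup>2) \<le> 3\<close> for every \<open>k\<close>
  (\<open>superharmonic_energy\<close>).

  Suppose that with probability \<open>p > 0\<close> all edges of \<open>E\<close> are crossed. Then each single edge is
  crossed with probability at least \<open>p\<close>, and comparing the sum over time with a sum over edges
  bounds the Dirichlet energy \<open>\<Sum>(x, y). (Z x - Z y)\<^sup>2\<close> over \<open>E\<close> by \<open>6 / p\<close>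
  (\<open>superharmonic_edge_energy\<close>). Randomness has disappeared: the \<open>Z\<close> are fixed functions on the
  fixed graph. On the covering event all of \<open>V\<close> is visited, while the maximal inequality for the
  supermartingale \<open>h(X n)\<close> makes late visits to \<open>{v. k * h v \<ge> 1}\<close> unlikely; hence
  only finitely many \<open>v \<in> V\<close> satisfy \<open>k * h v \<ge> 1\<close> (\<open>finite_superlevel_of_visited\<close>). So
  \<open>max 0 (2 Z - 1)\<close> is finitely supported on \<open>V\<close>, and it equals \<open>1\<close> on any given finite
  subset of \<open>V\<close> once \<open>k\<close> is large. The graph thus has finitely supported functions of uniformly
  bounded energy that are \<open>1\<close> on arbitrarily large finite sets
  (\<open>cutoffs_of_covering_chain\<close>).

  A transient graph has no such functions. The Green function of its simple random walk, divided
  by the degree, is a potential \<open>g\<close> whose gradient is a unit flow from some vertex \<open>r\<close> to infinity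
  with finite energy (\<open>transient_graph_unit_flow\<close>). Summation by parts gives
  \<open>f r = 1 / 2 * (\<Sum>(x, y). (f x - f y) * (g x - g y))\<close> for finitely supported \<open>f\<close>. If \<open>f\<close> is \<open>1\<close> on
  a large finite set, only edges in the tail of the energy of \<open>g\<close> contribute, and by
  Cauchy-Schwarz the right-hand side is small, contradicting \<open>f r = 1\<close>
  (\<open>flow_forbids_cutoffs\<close>).
\<close>

section \<open>The Markov property for functions of the whole past\<close>

context markov_chain
begin

text \<open>
  The law of \<open>[X 0, ..., X n]\<close>, built from the kernel alone. It turns integrals over the
  abstract probability space into integrals against discrete distributions, where the
  composition rules of \<^typ>\<open>'a pmf\<close> apply.
\<close>

primrec path_pmf :: "nat \<Rightarrow> 'a list pmf" where
  "path_pmf 0 = return_pmf [x0]"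
| "path_pmf (Suc n) =
     bind_pmf (path_pmf n) (\<lambda>xs. map_pmf (\<lambda>y. xs @ [y]) (P (last xs)))"

definition history :: "nat \<Rightarrow> 'm \<Rightarrow> 'a list" where
  "history n \<omega> = map (\<lambda>i. X i \<omega>) [0..<Suc n]"

lemma history_Suc: "history (Suc n) \<omega> = history n \<omega> @ [X (Suc n) \<omega>]"
  by (simp add: history_def)

lemma last_history [simp]: "last (history n \<omega>) = X n \<omega>"
  by (simp add: history_def)

lemma length_history [simp]: "length (history n \<omega>) = Suc n"
  by (simp add: history_def)

lemma X_in_U: "\<omega> \<in> space M \<Longrightarrow> X n \<omega> \<in> U"
  using measurable_space[OF measurable_step] by simp

lemma history_eq_iff:
  "history n \<omega> = zs \<longleftrightarrow> length zs = Suc n \<and> (\<forall>i\<le>n. X i \<omega> = zs ! i)"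
  unfolding history_def list_eq_iff_nth_eq by (auto simp del: upt_Suc simp: less_Suc_eq_le)

lemma measurable_history [measurable]: "history n \<in> measurable M (count_space UNIV)"
proof -
  have "history n \<in> measurable M (count_space (lists U))"
  proof (rule measurable_count_space_eq_countable[THEN iffD2])
    show "countable (lists U)" using countable_states by simp
    have "history n \<omega> \<in> lists U" if "\<omega> \<in> space M" for \<omega>
      using X_in_U[OF that] by (auto simp: history_def)
    moreover have "history n -` {zs} \<inter> space M \<in> sets M" for zs
    proof -
      have step: "{\<omega> \<in> space M. X i \<omega> = z} \<in> sets M" for i z
      proof (cases "z \<in> U")
        case True
        then show ?thesis
          using measurable_sets[OF measurable_step[of i], of "{z}"]
          by (simp add: vimage_def Int_def conj_commute)
      next
        case False
        then have "{\<omega> \<in> space M. X i \<omega> = z} = {}" using X_in_U by auto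
        then show ?thesis by (metis sets.empty_sets)
      qed
      have "history n -` {zs} \<inter> space M =
          {\<omega> \<in> space M. length zs = Suc n \<and> (\<forall>i\<in>{..n}. X i \<omega> = zs ! i)}"
        unfolding vimage_def by (auto simp add: history_eq_iff[of n _ zs] simp del: length_history)
      also have "\<dots> \<in> sets M"
        by (intro sets.sets_Collect_conj sets.sets_Collect_finite_All' step sets.sets_Collect_const) auto
      finally show ?thesis .
    qed
    ultimately show "history n \<in> space M \<rightarrow> lists U \<and>
        (\<forall>zs\<in>lists U. history n -` {zs} \<inter> space M \<in> sets M)"
      by blast
  qed
  then show ?thesis
    by (rule measurable_compose) simp
qed

lemma measurable_X [measurable]: "X n \<in> measurable M (count_space UNIV)"
proof -
  have "(\<lambda>\<omega>. last (history n \<omega>)) \<in> measurable M (count_space UNIV)"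
    by (rule measurable_compose[OF measurable_history]) simp
  then show ?thesis by simp
qed

lemma length_path_pmf: "xs \<in> set_pmf (path_pmf n) \<Longrightarrow> length xs = Suc n"
  by (induction n arbitrary: xs) auto

lemma pmf_path_pmf_Suc:
  "pmf (path_pmf (Suc n)) (xs @ [y]) = pmf (path_pmf n) xs * pmf (P (last xs)) y"
proof -
  have "pmf (map_pmf (\<lambda>y. ys @ [y]) (P (last ys))) (xs @ [y]) =
      indicator {xs} ys * pmf (P (last xs)) y" for ys
  proof (cases "ys = xs")
    case True
    then show ?thesis
      using pmf_map_inj'[of "\<lambda>y. xs @ [y]" "P (last xs)" y] by (simp add: inj_def)
  next
    case False
    then have "xs @ [y] \<notin> set_pmf (map_pmf (\<lambda>y. ys @ [y]) (P (last ys)))" by auto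
    then show ?thesis using False by (simp add: pmf_eq_0_set_pmf)
  qed
  then show ?thesis by (simp add: pmf_bind measure_pmf_single)
qed

lemma prob_history: "measure M {\<omega> \<in> space M. history n \<omega> = zs} = pmf (path_pmf n) zs"
proof (cases "length zs = Suc n")
  case False
  then have "zs \<notin> set_pmf (path_pmf n)" using length_path_pmf by auto
  moreover have empty: "{\<omega> \<in> space M. history n \<omega> = zs} = {}" using False by auto
  ultimately show ?thesis unfolding empty by (simp add: pmf_eq_0_set_pmf)
next
  case True
  then show ?thesis
  proof (induction n arbitrary: zs)
    case 0
    then obtain z where z: "zs = [z]" by (auto simp: length_Suc_conv)
    have "measure M {\<omega> \<in> space M. history 0 \<omega> = zs} = measure M {\<omega> \<in> space M. X 0 \<omega> = z}"
      by (simp add: history_def z)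
    also have "\<dots> = measure M (if z = x0 then space M else {})"
      using start by (intro finite_measure_eq_AE) auto
    finally show ?case by (simp add: z prob_space)
  next
    case (Suc n)
    then obtain xs y where zs: "zs = xs @ [y]" and len: "length xs = Suc n"
      by (metis length_Suc_conv_rev)
    have last: "last xs = zs ! n"
      using len by (metis zs diff_Suc_1 last_conv_nth length_0_conv lessI nat.distinct(1) nth_append)
    have nths: "zs ! i = xs ! i" if "i \<le> n" for i
      using that len by (simp add: zs nth_append)
    have y: "zs ! Suc n = y" using len by (simp add: zs nth_append)
    have "measure M {\<omega> \<in> space M. history (Suc n) \<omega> = zs} =
        measure M {\<omega> \<in> space M. \<forall>i\<le>n. X i \<omega> = zs ! i} * pmf (P (zs ! n)) (zs ! Suc n)"
      using Suc.prems markov_property[of n "\<lambda>i. zs ! i"] by (simp add: history_eq_iff)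
    also have "{\<omega> \<in> space M. \<forall>i\<le>n. X i \<omega> = zs ! i} = {\<omega> \<in> space M. history n \<omega> = xs}"
      using len nths by (auto simp: history_eq_iff)
    finally show ?case
      using Suc.IH[OF len] by (simp only: pmf_path_pmf_Suc[of n xs y, folded zs] last y)
  qed
qed

text \<open>
  Both sides live on countably many lists, so it suffices to compare singletons.
\<close>

lemma distr_history: "distr M (count_space UNIV) (history n) = measure_pmf (path_pmf n)"
proof (rule measure_eqI_countable_AE)
  let ?\<Omega> = "lists U \<union> set_pmf (path_pmf n)"
  show "countable ?\<Omega>" using countable_states by simp
  show "AE zs in distr M (count_space UNIV) (history n). zs \<in> ?\<Omega>"
  proof (subst AE_distr_iff)
    show "AE \<omega> in M. history n \<omega> \<in> ?\<Omega>"
      using X_in_U by (intro AE_I2) (auto simp: history_def)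
  qed auto
  show "AE zs in measure_pmf (path_pmf n). zs \<in> ?\<Omega>"
    by (auto simp: AE_measure_pmf_iff)
  show "emeasure (distr M (count_space UNIV) (history n)) {zs} = emeasure (measure_pmf (path_pmf n)) {zs}"
    for zs
    by (subst emeasure_distr)
      (auto simp: emeasure_pmf_single prob_history[symmetric] emeasure_eq_measure vimage_def Int_def conj_commute)
qed auto

lemma nn_integral_history: "(\<integral>\<^sup>+\<omega>. k (history n \<omega>) \<partial>M) = (\<integral>\<^sup>+xs. k xs \<partial>path_pmf n)"
  by (subst distr_history[symmetric], subst nn_integral_distr) auto

text \<open>
  The Markov property in the form in which it is used: integrating out the last step of the
  chain against an arbitrary weight \<open>k\<close> that depends on the past.
\<close>

lemma nn_integral_step:
  "(\<integral>\<^sup>+\<omega>. k (history n \<omega>) * F (X (Suc n) \<omega>) \<partial>M) =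
   (\<integral>\<^sup>+\<omega>. k (history n \<omega>) * (\<integral>\<^sup>+y. F y \<partial>P (X n \<omega>)) \<partial>M)"
proof -
  have "(\<integral>\<^sup>+\<omega>. k (history n \<omega>) * F (X (Suc n) \<omega>) \<partial>M) =
      (\<integral>\<^sup>+\<omega>. (\<lambda>zs. k (butlast zs) * F (last zs)) (history (Suc n) \<omega>) \<partial>M)"
    by (simp add: history_Suc)
  also have "\<dots> = (\<integral>\<^sup>+xs. k xs * (\<integral>\<^sup>+y. F y \<partial>P (last xs)) \<partial>path_pmf n)"
    by (subst nn_integral_history) (simp add: nn_integral_bind_pmf nn_integral_map_pmf nn_integral_cmult)
  also have "\<dots> = (\<integral>\<^sup>+\<omega>. k (history n \<omega>) * (\<integral>\<^sup>+y. F y \<partial>P (X n \<omega>)) \<partial>M)"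
    by (subst nn_integral_history[symmetric]) simp
  finally show ?thesis .
qed

lemma nn_integral_X: "(\<integral>\<^sup>+\<omega>. F (X n \<omega>) \<partial>M) = (\<integral>\<^sup>+x. F x \<partial>kernel_power P n x0)"
proof -
  have "map_pmf last (path_pmf n) = kernel_power P n x0"
  proof (induction n)
    case (Suc n)
    have "map_pmf last (path_pmf (Suc n)) = bind_pmf (path_pmf n) (\<lambda>xs. P (last xs))"
      by (simp add: map_bind_pmf map_pmf_comp)
    also have "\<dots> = bind_pmf (map_pmf last (path_pmf n)) P"
      by (simp add: bind_map_pmf)
    finally show ?case by (simp add: Suc.IH)
  qed simp
  then have "(\<integral>\<^sup>+x. F x \<partial>kernel_power P n x0) = (\<integral>\<^sup>+xs. F (last xs) \<partial>path_pmf n)"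
    by (metis nn_integral_map_pmf)
  then show ?thesis using nn_integral_history[of "\<lambda>xs. F (last xs)" n] by simp
qed

end

section \<open>Green functions\<close>

lemma kernel_power_add:
  "kernel_power P (n + m) x = bind_pmf (kernel_power P n x) (kernel_power P m)"
  by (induction m) (simp_all add: bind_return_pmf' bind_assoc_pmf)

definition green :: "('a \<Rightarrow> 'a pmf) \<Rightarrow> 'a \<Rightarrow> 'a \<Rightarrow> ennreal" where
  "green P x y = (\<Sum>n. ennreal (pmf (kernel_power P n x) y))"

lemma nn_integral_green:
  fixes P :: "'a \<Rightarrow> 'a pmf"
  shows "(\<integral>\<^sup>+y. green P y z \<partial>kernel_power P n x) = (\<Sum>m. ennreal (pmf (kernel_power P (n + m) x) z))"
  unfolding green_def kernel_power_add ennreal_pmf_bind by (rule nn_integral_suminf) simp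

text \<open>
  Taking one step first discards the visit at time \<open>0\<close>.
\<close>

lemma green_superharmonic:
  fixes P :: "'a \<Rightarrow> 'a pmf"
  shows "(\<integral>\<^sup>+y. green P y z \<partial>P x) \<le> green P x z"
proof -
  define f where "f n = ennreal (pmf (kernel_power P n x) z)" for n
  have one: "kernel_power P 1 x = P x" by (simp add: bind_return_pmf)
  have "(\<integral>\<^sup>+y. green P y z \<partial>P x) = (\<Sum>m. f (m + 1))"
    using nn_integral_green[of P 1 x z] unfolding one f_def by (simp only: add.commute[of 1])
  also have "\<dots> \<le> (\<Sum>m. f (m + 1)) + (\<Sum>j<1. f j)"
    by (rule add_increasing2) simp_all
  also have "\<dots> = green P x z"
    unfolding green_def f_def[symmetric] by (rule suminf_offset[symmetric]) auto
  finally show ?thesis .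
qed

lemma green_pos:
  assumes "irreducible_kernel U P" "x \<in> U" "y \<in> U"
  shows "green P x y > 0"
proof -
  obtain n where n: "pmf (kernel_power P n x) y > 0"
    using assms unfolding irreducible_kernel_def by blast
  have "ennreal (pmf (kernel_power P n x) y) \<le> green P x y"
    unfolding green_def
    using sum_le_suminf[OF summableI, of "{n}" "\<lambda>n. ennreal (pmf (kernel_power P n x) y)"]
    by (simp only: sum.insert sum.empty finite.intros empty_iff not_False_eq_True add_0_right zero_le simp_thms)
  moreover have "0 < ennreal (pmf (kernel_power P n x) y)"
    using n by (simp only: ennreal_less_zero_iff)
  ultimately show ?thesis by (rule less_le_trans[rotated])
qed

text \<open>
  The integral is the expected number of visits to \<open>z\<close> from time \<open>n\<close> on, that is, the tail of
  the convergent series \<open>green P z z\<close>.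
\<close>

lemma green_tail:
  assumes "green P z z < \<top>"
  shows "(\<lambda>n. \<integral>\<^sup>+y. green P y z \<partial>kernel_power P n z) \<longlonglongrightarrow> 0"
proof -
  let ?a = "\<lambda>n. pmf (kernel_power P n z) z"
  have sm: "summable ?a"
    using assms unfolding green_def by (intro summable_suminf_not_top) auto
  have eq: "(\<integral>\<^sup>+y. green P y z \<partial>kernel_power P n z) = ennreal (\<Sum>m. ?a (m + n))" for n
    unfolding nn_integral_green add.commute[of n]
    using summable_ignore_initial_segment[OF sm, of n] by (intro suminf_ennreal2) simp_all
  have "(\<lambda>n. \<Sum>m. ?a (m + n)) \<longlonglongrightarrow> 0"
  proof (rule LIMSEQ_I)
    fix r :: real assume "0 < r"
    from suminf_exist_split[OF this sm]
    show "\<exists>N. \<forall>n\<ge>N. norm ((\<Sum>m. ?a (m + n)) - 0) < r" by (simp only: diff_zero)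
  qed
  then show ?thesis
    unfolding eq using tendsto_ennrealI[of "\<lambda>n. \<Sum>m. ?a (m + n)" 0] by (simp only: ennreal_0)
qed

section \<open>Transience and the maximal inequality\<close>

context markov_chain
begin

lemma pred_X [measurable]: "Measurable.pred M (\<lambda>\<omega>. X m \<omega> \<in> S)"
  by (rule measurable_compose[OF measurable_X]) simp

text \<open>
  \<open>avoid N x\<close> is the probability that the chain started at \<open>x\<close> does not visit \<open>x0\<close> at the times
  \<open>1, ..., N\<close>.
\<close>

primrec avoid :: "nat \<Rightarrow> 'a \<Rightarrow> ennreal" where
  "avoid 0 x = 1"
| "avoid (Suc N) x = (\<integral>\<^sup>+y. indicator (- {x0}) y * avoid N y \<partial>P x)"

lemma nn_integral_avoid:
  "(\<integral>\<^sup>+\<omega>. k (history n \<omega>) * indicator {\<omega>. \<forall>m\<in>{n<..n+N}. X m \<omega> \<noteq> x0} \<omega> \<partial>M) =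
   (\<integral>\<^sup>+\<omega>. k (history n \<omega>) * avoid N (X n \<omega>) \<partial>M)"
proof (induction N arbitrary: n k)
  case (Suc N)
  define k' where "k' zs = k (butlast zs) * indicator (- {x0}) (last zs)" for zs
  have k': "k' (history (Suc n) \<omega>) = k (history n \<omega>) * indicator (- {x0}) (X (Suc n) \<omega>)" for \<omega>
    by (simp add: k'_def history_Suc)
  have split: "{n<..n + Suc N} = insert (Suc n) {Suc n<..Suc n + N}" by auto
  have "(\<integral>\<^sup>+\<omega>. k (history n \<omega>) * indicator {\<omega>. \<forall>m\<in>{n<..n+Suc N}. X m \<omega> \<noteq> x0} \<omega> \<partial>M) =
      (\<integral>\<^sup>+\<omega>. k' (history (Suc n) \<omega>) * indicator {\<omega>. \<forall>m\<in>{Suc n<..Suc n+N}. X m \<omega> \<noteq> x0} \<omega> \<partial>M)"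
    unfolding k' split by (intro nn_integral_cong) (auto split: split_indicator)
  also have "\<dots> = (\<integral>\<^sup>+\<omega>. k (history n \<omega>) *
      (\<lambda>y. indicator (- {x0}) y * avoid N y) (X (Suc n) \<omega>) \<partial>M)"
    by (subst Suc.IH) (simp add: k' mult.assoc)
  also have "\<dots> = (\<integral>\<^sup>+\<omega>. k (history n \<omega>) * avoid (Suc N) (X n \<omega>) \<partial>M)"
    using nn_integral_step[of k n "\<lambda>y. indicator (- {x0}) y * avoid N y"] by simp
  finally show ?case .
qed simp

lemma emeasure_last_visit_upto:
  "emeasure M {\<omega> \<in> space M. X n \<omega> = x0 \<and> (\<forall>m\<in>{n<..n+N}. X m \<omega> \<noteq> x0)} =
   ennreal (pmf (kernel_power P n x0) x0) * avoid N x0"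
proof -
  have "emeasure M {\<omega> \<in> space M. X n \<omega> = x0 \<and> (\<forall>m\<in>{n<..n+N}. X m \<omega> \<noteq> x0)} =
      (\<integral>\<^sup>+\<omega>. indicator {\<omega> \<in> space M. X n \<omega> = x0 \<and> (\<forall>m\<in>{n<..n+N}. X m \<omega> \<noteq> x0)} \<omega> \<partial>M)"
    by (subst nn_integral_indicator) measurable
  also have "\<dots> = (\<integral>\<^sup>+\<omega>. (\<lambda>zs. indicator {x0} (last zs)) (history n \<omega>) *
      indicator {\<omega>. \<forall>m\<in>{n<..n+N}. X m \<omega> \<noteq> x0} \<omega> \<partial>M)"
    by (intro nn_integral_cong) (auto split: split_indicator)
  also have "\<dots> = (\<integral>\<^sup>+\<omega>. (\<lambda>zs. indicator {x0} (last zs)) (history n \<omega>) * avoid N (X n \<omega>) \<partial>M)"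
    by (rule nn_integral_avoid[where k = "\<lambda>zs. indicator {x0} (last zs)"])
  also have "\<dots> = (\<integral>\<^sup>+\<omega>. (\<lambda>x. indicator {x0} x * avoid N x0) (X n \<omega>) \<partial>M)"
    by (intro nn_integral_cong) (auto split: split_indicator)
  also have "\<dots> = ennreal (pmf (kernel_power P n x0) x0) * avoid N x0"
    by (subst nn_integral_X) (simp add: nn_integral_multc emeasure_pmf_single)
  finally show ?thesis .
qed

text \<open>
  Decompose by the time of the last visit to \<open>x0\<close>. By the Markov property, \<open>n\<close> is the last
  visiting time with probability \<open>p\<^sub>n * e\<close>, where \<open>p\<^sub>n\<close> is the \<open>n\<close>-step return probability and \<open>e\<close> the
  probability of never returning. If the chain is not recurrent, some of these probabilities is
  positive, so \<open>e > 0\<close>; and as they add up to at most \<open>1\<close>, the series of the \<open>p\<^sub>n\<close> converges.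
  In the proof, \<open>c\<close> is a lower bound for \<open>e\<close>.
\<close>

lemma transient_imp_green_finite:
  assumes "transient_chain M x0 X"
  shows "green P x0 x0 < \<top>"
proof -
  define L where "L n = {\<omega> \<in> space M. X n \<omega> = x0 \<and> (\<forall>m>n. X m \<omega> \<noteq> x0)}" for n
  have [measurable]: "L n \<in> sets M" for n unfolding L_def by measurable
  have L_le: "emeasure M (L n) \<le> ennreal (pmf (kernel_power P n x0) x0) * avoid N x0" for n N
    unfolding emeasure_last_visit_upto[symmetric] L_def
  proof (rule emeasure_mono)
    show "{\<omega> \<in> space M. X n \<omega> = x0 \<and> (\<forall>m>n. X m \<omega> \<noteq> x0)} \<subseteq>
        {\<omega> \<in> space M. X n \<omega> = x0 \<and> (\<forall>m\<in>{n<..n+N}. X m \<omega> \<noteq> x0)}"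
      by auto
  qed measurable
  have L_INF: "emeasure M (L n) = (INF N. ennreal (pmf (kernel_power P n x0) x0) * avoid N x0)" for n
  proof -
    let ?A = "\<lambda>N. {\<omega> \<in> space M. X n \<omega> = x0 \<and> (\<forall>m\<in>{n<..n+N}. X m \<omega> \<noteq> x0)}"
    have "L n = (\<Inter>N. ?A N)"
    proof (intro equalityI subsetI INT_I)
      fix \<omega> assume *: "\<omega> \<in> (\<Inter>N. ?A N)"
      have "X m \<omega> \<noteq> x0" if "m > n" for m
        using * that by (auto dest!: spec[of _ "m - n"])
      with * show "\<omega> \<in> L n" by (auto simp: L_def)
    qed (auto simp: L_def)
    moreover have "range ?A \<subseteq> sets M" by (intro image_subsetI) measurable
    moreover have "decseq ?A"
    proof (unfold decseq_def, intro allI impI)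
      fix N N' :: nat
      assume "N \<le> N'"
      then have "{n<..n+N} \<subseteq> {n<..n+N'}" by auto
      then show "?A N' \<subseteq> ?A N" by blast
    qed
    ultimately have "emeasure M (L n) = (INF N. emeasure M (?A N))"
      using INF_emeasure_decseq[of ?A M] by (simp only: infinity_ennreal_def emeasure_finite simp_thms)
    then show ?thesis by (simp only: emeasure_last_visit_upto)
  qed
  have "\<exists>n. emeasure M (L n) > 0"
  proof (rule ccontr)
    assume "\<nexists>n. emeasure M (L n) > 0"
    then have "AE \<omega> in M. \<omega> \<notin> L n" for n
      by (intro AE_not_in) (auto simp: null_sets_def zero_less_iff_neq_zero)
    then have "AE \<omega> in M. \<forall>n. \<omega> \<notin> L n" by (simp add: AE_all_countable)
    with start AE_space have "AE \<omega> in M. infinite {n. X n \<omega> = x0}"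
    proof eventually_elim
      case (elim \<omega>)
      show ?case
      proof
        assume fin: "finite {n. X n \<omega> = x0}"
        define n where "n = Max {n. X n \<omega> = x0}"
        have "X n \<omega> = x0" using Max_in[OF fin] elim(1) by (auto simp: n_def)
        moreover have "X m \<omega> \<noteq> x0" if "m > n" for m
          using Max_ge[OF fin, of m] that by (auto simp: n_def)
        ultimately show False using elim by (auto simp: L_def)
      qed
    qed
    then show False using assms by (simp add: recurrent_chain_def)
  qed
  then obtain n0 where n0: "emeasure M (L n0) > 0" by blast
  define c where "c = emeasure M (L n0)"
  have c: "c \<le> avoid N x0" for N
  proof -
    have "c \<le> ennreal (pmf (kernel_power P n0 x0) x0) * avoid N x0"
      unfolding c_def by (rule L_le)
    also have "\<dots> \<le> 1 * avoid N x0"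
      by (intro mult_right_mono) (auto simp: pmf_le_1)
    finally show ?thesis by simp
  qed
  have "ennreal (pmf (kernel_power P n x0) x0) * c \<le> emeasure M (L n)" for n
    unfolding L_INF by (intro INF_greatest mult_left_mono c) auto
  then have "(\<Sum>n. ennreal (pmf (kernel_power P n x0) x0) * c) \<le> (\<Sum>n. emeasure M (L n))"
    by (intro suminf_le) auto
  also have "\<dots> = emeasure M (\<Union>n. L n)"
  proof (rule suminf_emeasure)
    show "disjoint_family L"
    proof (unfold disjoint_family_on_def, intro ballI impI)
      fix i j :: nat assume "i \<noteq> j"
      then consider "i < j" | "j < i" by linarith
      then have "\<omega> \<notin> L j" if "\<omega> \<in> L i" for \<omega>
      proof cases
        case 1
        with that have "X j \<omega> \<noteq> x0" by (simp add: L_def)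
        then show ?thesis by (simp add: L_def)
      next
        case 2
        from that have "X i \<omega> = x0" by (simp add: L_def)
        with 2 show ?thesis by (metis (mono_tags, lifting) L_def mem_Collect_eq)
      qed
      then show "L i \<inter> L j = {}" by blast
    qed
  qed auto
  also have "\<dots> \<le> 1" by (rule emeasure_le_1)
  finally have "green P x0 x0 * c \<le> 1" by (simp add: green_def)
  moreover have "\<top> * c = \<top>" using n0 by (simp add: c_def ennreal_top_mult)
  ultimately have "green P x0 x0 \<noteq> \<top>" by (metis ennreal_one_neq_top top.extremum_unique)
  then show ?thesis by (metis top.not_eq_extremum)
qed

text \<open>
  The maximal inequality for the nonnegative supermartingale \<open>h (X n)\<close>. The weight \<open>k\<close> of the past
  is what makes the induction on the length \<open>N\<close> of the time window work: paths that are outside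
  \<open>S\<close> at time \<open>n\<close> are passed on to time \<open>n + 1\<close>, with this restriction absorbed into the weight.
\<close>

lemma nn_integral_maximal:
  assumes super: "\<And>x. (\<integral>\<^sup>+y. h y \<partial>P x) \<le> h x" and S: "\<And>x. x \<in> S \<Longrightarrow> 1 \<le> h x"
  shows "(\<integral>\<^sup>+\<omega>. k (history n \<omega>) * indicator {\<omega>. \<exists>m\<in>{n..n+N}. X m \<omega> \<in> S} \<omega> \<partial>M) \<le>
    (\<integral>\<^sup>+\<omega>. k (history n \<omega>) * h (X n \<omega>) \<partial>M)"
proof (induction N arbitrary: n k)
  case 0
  show ?case using S by (intro nn_integral_mono mult_left_mono) (auto split: split_indicator)
next
  case (Suc N)
  \<comment> \<open>split according to whether \<open>X n\<close> is in \<open>S\<close>; \<open>k2\<close> is \<open>k1\<close> read one step later\<close>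
  define k0 where "k0 zs = k zs * indicator S (last zs)" for zs
  define k1 where "k1 zs = k zs * indicator (- S) (last zs)" for zs
  define k2 where "k2 zs = k1 (butlast zs)" for zs
  have mk: "(\<lambda>\<omega>. g (history j \<omega>)) \<in> borel_measurable M" for g :: "'a list \<Rightarrow> ennreal" and j
    by (rule measurable_compose[OF measurable_history]) simp
  have k2: "k2 (history (Suc n) \<omega>) = k1 (history n \<omega>)" for \<omega>
    by (simp add: k2_def history_Suc)
  have split: "{n..n + Suc N} = insert n {Suc n..Suc n + N}" by auto
  have "{\<omega> \<in> space M. \<exists>m\<in>{Suc n..Suc n+N}. X m \<omega> \<in> S} \<in> sets M"
    by measurable
  then have ind: "{\<omega>. \<exists>m\<in>{Suc n..Suc n+N}. X m \<omega> \<in> S} \<inter> space M \<in> sets M"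
    by (simp add: Int_def conj_commute)
  have "(\<integral>\<^sup>+\<omega>. k (history n \<omega>) * indicator {\<omega>. \<exists>m\<in>{n..n+Suc N}. X m \<omega> \<in> S} \<omega> \<partial>M) =
      (\<integral>\<^sup>+\<omega>. k0 (history n \<omega>) +
        k2 (history (Suc n) \<omega>) * indicator {\<omega>. \<exists>m\<in>{Suc n..Suc n+N}. X m \<omega> \<in> S} \<omega> \<partial>M)"
    unfolding k2 k0_def k1_def split by (intro nn_integral_cong) (auto split: split_indicator)
  also have "\<dots> = (\<integral>\<^sup>+\<omega>. k0 (history n \<omega>) \<partial>M) +
      (\<integral>\<^sup>+\<omega>. k2 (history (Suc n) \<omega>) * indicator {\<omega>. \<exists>m\<in>{Suc n..Suc n+N}. X m \<omega> \<in> S} \<omega> \<partial>M)"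
    using mk[of k0 n] borel_measurable_times_ennreal[OF mk[of k2 "Suc n"]
      borel_measurable_indicator_iff[THEN iffD2, OF ind]]
    by (rule nn_integral_add)
  also have "\<dots> \<le> (\<integral>\<^sup>+\<omega>. k0 (history n \<omega>) \<partial>M) +
      (\<integral>\<^sup>+\<omega>. k2 (history (Suc n) \<omega>) * h (X (Suc n) \<omega>) \<partial>M)"
    by (intro add_left_mono Suc.IH)
  also have "\<dots> = (\<integral>\<^sup>+\<omega>. k0 (history n \<omega>) \<partial>M) +
      (\<integral>\<^sup>+\<omega>. k1 (history n \<omega>) * (\<integral>\<^sup>+y. h y \<partial>P (X n \<omega>)) \<partial>M)"
    unfolding k2 nn_integral_step ..
  also have "\<dots> \<le> (\<integral>\<^sup>+\<omega>. k0 (history n \<omega>) * h (X n \<omega>) \<partial>M) +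
      (\<integral>\<^sup>+\<omega>. k1 (history n \<omega>) * h (X n \<omega>) \<partial>M)"
  proof (intro add_mono nn_integral_mono)
    fix \<omega>
    show "k0 (history n \<omega>) \<le> k0 (history n \<omega>) * h (X n \<omega>)"
      using mult_left_mono[OF S, of "X n \<omega>" "k (history n \<omega>)"]
      by (auto simp: k0_def split: split_indicator)
    show "k1 (history n \<omega>) * (\<integral>\<^sup>+y. h y \<partial>P (X n \<omega>)) \<le> k1 (history n \<omega>) * h (X n \<omega>)"
      by (intro mult_left_mono super) auto
  qed
  also have "\<dots> = (\<integral>\<^sup>+\<omega>. k0 (history n \<omega>) * h (X n \<omega>) + k1 (history n \<omega>) * h (X n \<omega>) \<partial>M)"
    using mk[of "\<lambda>zs. k0 zs * h (last zs)" n] mk[of "\<lambda>zs. k1 zs * h (last zs)" n]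
    by (subst nn_integral_add) simp_all
  also have "\<dots> = (\<integral>\<^sup>+\<omega>. k (history n \<omega>) * h (X n \<omega>) \<partial>M)"
    by (intro nn_integral_cong) (auto simp: k0_def k1_def split: split_indicator)
  finally show ?case .
qed

lemma emeasure_visit_after_le:
  assumes super: "\<And>x. (\<integral>\<^sup>+y. h y \<partial>P x) \<le> h x" and S: "\<And>x. x \<in> S \<Longrightarrow> 1 \<le> h x"
  shows "emeasure M {\<omega> \<in> space M. \<exists>m\<ge>n. X m \<omega> \<in> S} \<le> (\<integral>\<^sup>+x. h x \<partial>kernel_power P n x0)"
proof -
  let ?A = "\<lambda>N. {\<omega> \<in> space M. \<exists>m\<in>{n..n+N}. X m \<omega> \<in> S}"
  have "emeasure M (?A N) \<le> (\<integral>\<^sup>+x. h x \<partial>kernel_power P n x0)" for N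
  proof -
    have "emeasure M (?A N) = (\<integral>\<^sup>+\<omega>. indicator (?A N) \<omega> \<partial>M)"
      by (subst nn_integral_indicator) measurable
    also have "\<dots> = (\<integral>\<^sup>+\<omega>. (\<lambda>_. 1) (history n \<omega>) * indicator {\<omega>. \<exists>m\<in>{n..n+N}. X m \<omega> \<in> S} \<omega> \<partial>M)"
      by (intro nn_integral_cong) (auto split: split_indicator)
    also have "\<dots> \<le> (\<integral>\<^sup>+\<omega>. (\<lambda>_. 1) (history n \<omega>) * h (X n \<omega>) \<partial>M)"
      by (rule nn_integral_maximal[OF super S])
    finally show ?thesis by (simp add: nn_integral_X)
  qed
  moreover have "{\<omega> \<in> space M. \<exists>m\<ge>n. X m \<omega> \<in> S} = (\<Union>N. ?A N)"
    by (auto simp: Bex_def) (metis le_add_diff_inverse order_refl)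
  moreover have "emeasure M (\<Union>N. ?A N) = (SUP N. emeasure M (?A N))"
  proof (rule SUP_emeasure_incseq[symmetric])
    show "range ?A \<subseteq> sets M" by (intro image_subsetI) measurable
    show "incseq ?A"
    proof (unfold incseq_def, intro allI impI)
      fix N N' :: nat
      assume "N \<le> N'"
      then have "{n..n+N} \<subseteq> {n..n+N'}" by auto
      then show "?A N \<subseteq> ?A N'" by blast
    qed
  qed
  ultimately show ?thesis by (simp add: SUP_le_iff)
qed

end

section \<open>The energy of bounded superharmonic functions along the chain\<close>

text \<open>
  The joint law of two consecutive states of the chain when the first has law \<open>p\<close>.
\<close>

definition edge_pmf :: "('a \<Rightarrow> 'a pmf) \<Rightarrow> 'a pmf \<Rightarrow> ('a \<times> 'a) pmf" where
  "edge_pmf P p = bind_pmf p (\<lambda>x. map_pmf (Pair x) (P x))"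

lemma pmf_edge_pmf: "pmf (edge_pmf P p) (x, y) = pmf p x * pmf (P x) y"
proof -
  have "pmf (map_pmf (Pair z) (P z)) (x, y) = indicator {x} z * pmf (P x) y" for z
  proof (cases "z = x")
    case True
    then show ?thesis
      using pmf_map_inj'[of "Pair x" "P x" y] by (simp add: inj_def)
  next
    case False
    then have "(x, y) \<notin> set_pmf (map_pmf (Pair z) (P z))" by auto
    then show ?thesis using False by (simp add: pmf_eq_0_set_pmf)
  qed
  then show ?thesis by (simp add: edge_pmf_def pmf_bind measure_pmf_single)
qed

lemma map_fst_edge_pmf: "map_pmf fst (edge_pmf P p) = p"
  by (simp add: edge_pmf_def map_bind_pmf map_pmf_comp bind_return_pmf')

lemma map_snd_edge_pmf: "map_pmf snd (edge_pmf P p) = bind_pmf p P"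
  by (simp add: edge_pmf_def map_bind_pmf map_pmf_comp)

lemma integrable_pmf_bounded:
  fixes f :: "'b \<Rightarrow> real"
  assumes "\<And>x. \<bar>f x\<bar> \<le> B"
  shows "integrable (measure_pmf p) f"
  using assms by (intro measure_pmf.integrable_const_bound[where B = B]) auto

text \<open>
  Expand \<open>(Z x - Z y)\<^sup>2 = Z y\<^sup>2 - Z x\<^sup>2 + 2 * Z x * (Z x - Z y)\<close>. Since the drift \<open>Z x - E Z y\<close> is
  nonnegative and \<open>Z x \<le> 1\<close>, the factor \<open>Z x\<close> in the last term may be replaced by \<open>1\<close>, after
  which everything telescopes in time through the quantity \<open>sq\<close>.
\<close>

lemma superharmonic_energy_step:
  fixes P :: "'a \<Rightarrow> 'a pmf" and Z :: "'a \<Rightarrow> real"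
  assumes Z0: "\<And>x. 0 \<le> Z x" and Z1: "\<And>x. Z x \<le> 1"
    and super: "\<And>x. (\<integral>\<^sup>+y. Z y \<partial>P x) \<le> Z x"
  defines "\<And>q. sq q \<equiv> (\<integral>x. (Z x)\<^sup>2 \<partial>measure_pmf q) - 2 * (\<integral>x. Z x \<partial>measure_pmf q)"
  shows "(\<integral>t. (Z (fst t) - Z (snd t))\<^sup>2 \<partial>edge_pmf P p) \<le> sq (bind_pmf p P) - sq p"
proof -
  let ?D = "edge_pmf P p"
  note int = integrable_pmf_bounded[where B = 1]
  have Zab: "\<bar>Z x\<bar> \<le> 1" for x using Z0[of x] Z1[of x] by simp
  have Zsq: "\<bar>(Z x)\<^sup>2\<bar> \<le> 1" for x using Zab[of x] by (simp add: abs_square_le_1)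
  have Zmul: "\<bar>Z x * Z y\<bar> \<le> 1" for x y
    using Zab mult_le_one[of "\<bar>Z x\<bar>" "\<bar>Z y\<bar>"] by (simp add: abs_mult)
  have i1: "integrable ?D (\<lambda>t. Z (fst t))" "integrable ?D (\<lambda>t. Z (snd t))"
    "integrable ?D (\<lambda>t. (Z (fst t))\<^sup>2)" "integrable ?D (\<lambda>t. (Z (snd t))\<^sup>2)"
    "integrable ?D (\<lambda>t. Z (fst t) * Z (snd t))"
    by (rule int, rule Zab Zsq Zmul)+
  have fst: "(\<integral>t. g (fst t) \<partial>?D) = (\<integral>x. g x \<partial>p)" for g :: "'a \<Rightarrow> real"
    using integral_map_pmf[of fst ?D g] by (simp add: map_fst_edge_pmf)
  have snd: "(\<integral>t. g (snd t) \<partial>?D) = (\<integral>x. g x \<partial>bind_pmf p P)" for g :: "'a \<Rightarrow> real"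
    using integral_map_pmf[of snd ?D g] by (simp add: map_snd_edge_pmf)
  have key: "(\<integral>t. (1 - Z (fst t)) * Z (snd t) \<partial>?D) \<le> (\<integral>t. (1 - Z (fst t)) * Z (fst t) \<partial>?D)"
  proof -
    have nn: "(\<integral>\<^sup>+t. f t \<partial>?D) = ennreal (\<integral>t. f t \<partial>?D)"
      if "integrable ?D f" "\<And>t. 0 \<le> f t" for f :: "'a \<times> 'a \<Rightarrow> real"
      using that by (intro nn_integral_eq_integral) auto
    have ii: "integrable ?D (\<lambda>t. (1 - Z (fst t)) * Z (snd t))"
      "integrable ?D (\<lambda>t. (1 - Z (fst t)) * Z (fst t))"
      using i1 by (auto simp: left_diff_distrib power2_eq_square)
    have "(\<integral>\<^sup>+t. (1 - Z (fst t)) * Z (snd t) \<partial>?D) =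
        (\<integral>\<^sup>+x. ennreal (1 - Z x) * (\<integral>\<^sup>+y. Z y \<partial>P x) \<partial>p)"
      using Z0 Z1 by (simp add: edge_pmf_def ennreal_mult nn_integral_cmult)
    also have "\<dots> \<le> (\<integral>\<^sup>+x. ennreal (1 - Z x) * Z x \<partial>p)"
      by (intro nn_integral_mono mult_left_mono super) auto
    also have "\<dots> = (\<integral>\<^sup>+t. (1 - Z (fst t)) * Z (fst t) \<partial>?D)"
      using Z0 Z1 by (simp add: edge_pmf_def ennreal_mult)
    finally show ?thesis
      using Z0 Z1 ii by (subst (asm) (1 2) nn) (auto intro!: integral_nonneg_AE)
  qed
  have "(\<integral>t. (Z (fst t) - Z (snd t))\<^sup>2 \<partial>?D) =
      (\<integral>t. (Z (snd t))\<^sup>2 - (Z (fst t))\<^sup>2 + 2 * (Z (fst t) - Z (snd t))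
        + 2 * ((1 - Z (fst t)) * Z (snd t) - (1 - Z (fst t)) * Z (fst t)) \<partial>?D)"
    by (intro Bochner_Integration.integral_cong) (auto simp: power2_eq_square algebra_simps)
  also have "\<dots> = (\<integral>t. (Z (snd t))\<^sup>2 \<partial>?D) - (\<integral>t. (Z (fst t))\<^sup>2 \<partial>?D)
      + 2 * ((\<integral>t. Z (fst t) \<partial>?D) - (\<integral>t. Z (snd t) \<partial>?D))
      + 2 * ((\<integral>t. (1 - Z (fst t)) * Z (snd t) \<partial>?D) - (\<integral>t. (1 - Z (fst t)) * Z (fst t) \<partial>?D))"
    using i1 by (simp add: left_diff_distrib power2_eq_square)
  also have "\<dots> \<le> sq (bind_pmf p P) - sq p"
    using key unfolding fst[of Z] fst[of "\<lambda>x. (Z x)\<^sup>2"] snd[of Z] snd[of "\<lambda>x. (Z x)\<^sup>2"] sq_def by simp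
  finally show ?thesis .
qed

lemma superharmonic_energy:
  fixes P :: "'a \<Rightarrow> 'a pmf" and Z :: "'a \<Rightarrow> real"
  assumes Z0: "\<And>x. 0 \<le> Z x" and Z1: "\<And>x. Z x \<le> 1"
    and super: "\<And>x. (\<integral>\<^sup>+y. Z y \<partial>P x) \<le> Z x"
  shows "(\<Sum>n<N. \<integral>t. (Z (fst t) - Z (snd t))\<^sup>2 \<partial>edge_pmf P (kernel_power P n x)) \<le> 3"
proof -
  define sq where "sq q = (\<integral>x. (Z x)\<^sup>2 \<partial>measure_pmf q) - 2 * (\<integral>x. Z x \<partial>measure_pmf q)" for q
  have "(\<Sum>n<N. \<integral>t. (Z (fst t) - Z (snd t))\<^sup>2 \<partial>edge_pmf P (kernel_power P n x)) \<le>
      (\<Sum>n<N. sq (kernel_power P (Suc n) x) - sq (kernel_power P n x))"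
    unfolding sq_def kernel_power.simps
    by (intro sum_mono superharmonic_energy_step assms)
  also have "\<dots> = sq (kernel_power P N x) - sq (kernel_power P 0 x)"
    by (rule sum_lessThan_telescope)
  also have "\<dots> \<le> 3"
  proof -
    have b: "0 \<le> (\<integral>y. f y \<partial>measure_pmf q) \<and> (\<integral>y. f y \<partial>measure_pmf q) \<le> 1"
      if "\<And>y. 0 \<le> f y" "\<And>y. f y \<le> 1" for f :: "'a \<Rightarrow> real" and q
      using that by (auto intro!: integral_nonneg_AE measure_pmf.integral_le_const
          integrable_pmf_bounded[where B = 1])
    have sqb: "0 \<le> (Z y)\<^sup>2" "(Z y)\<^sup>2 \<le> 1" for y
      using Z0[of y] Z1[of y] by (auto simp: power_le_one)
    show ?thesis
      using b[of "\<lambda>y. (Z y)\<^sup>2", OF sqb] b[of Z, OF Z0 Z1] unfolding sq_def by smt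
  qed
  finally show ?thesis .
qed

context markov_chain
begin

lemma emeasure_step_eq:
  "emeasure M {\<omega> \<in> space M. X n \<omega> = x \<and> X (Suc n) \<omega> = y} =
   ennreal (pmf (edge_pmf P (kernel_power P n x0)) (x, y))"
proof -
  have "emeasure M {\<omega> \<in> space M. X n \<omega> = x \<and> X (Suc n) \<omega> = y} =
      (\<integral>\<^sup>+\<omega>. indicator {\<omega> \<in> space M. X n \<omega> = x \<and> X (Suc n) \<omega> = y} \<omega> \<partial>M)"
    by (subst nn_integral_indicator) measurable
  also have "\<dots> = (\<integral>\<^sup>+\<omega>. (\<lambda>zs. indicator {x} (last zs)) (history n \<omega>) * indicator {y} (X (Suc n) \<omega>) \<partial>M)"
    by (intro nn_integral_cong) (auto split: split_indicator)
  also have "\<dots> = (\<integral>\<^sup>+\<omega>. (\<lambda>zs. indicator {x} (last zs)) (history n \<omega>) * (\<integral>\<^sup>+z. indicator {y} z \<partial>P (X n \<omega>)) \<partial>M)"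
    by (rule nn_integral_step[where k = "\<lambda>zs. indicator {x} (last zs)"])
  also have "\<dots> = (\<integral>\<^sup>+\<omega>. (\<lambda>z. indicator {x} z * ennreal (pmf (P x) y)) (X n \<omega>) \<partial>M)"
    by (intro nn_integral_cong) (auto simp: emeasure_pmf_single split: split_indicator)
  also have "\<dots> = ennreal (pmf (edge_pmf P (kernel_power P n x0)) (x, y))"
    by (subst nn_integral_X) (simp add: nn_integral_multc emeasure_pmf_single pmf_edge_pmf ennreal_mult)
  finally show ?thesis .
qed

definition expected_crossings :: "'a \<times> 'a \<Rightarrow> ennreal" where
  "expected_crossings t = (\<Sum>n. ennreal (pmf (edge_pmf P (kernel_power P n x0)) t))"

lemma sets_crosses_edge [measurable]: "{\<omega> \<in> space M. crosses_edge X \<omega> {x, y}} \<in> sets M"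
  unfolding crosses_edge_def doubleton_eq_iff by measurable

lemma emeasure_crosses_edge_le:
  "emeasure M {\<omega> \<in> space M. crosses_edge X \<omega> {x, y}} \<le>
   expected_crossings (x, y) + expected_crossings (y, x)"
proof -
  let ?A = "\<lambda>x y n. {\<omega> \<in> space M. X n \<omega> = x \<and> X (Suc n) \<omega> = y}"
  have [measurable]: "?A x y n \<in> sets M" for x y n by measurable
  have "{\<omega> \<in> space M. crosses_edge X \<omega> {x, y}} = (\<Union>n. ?A x y n) \<union> (\<Union>n. ?A y x n)"
    by (auto simp: crosses_edge_def doubleton_eq_iff)
  then have "emeasure M {\<omega> \<in> space M. crosses_edge X \<omega> {x, y}} \<le>
      emeasure M (\<Union>n. ?A x y n) + emeasure M (\<Union>n. ?A y x n)"
    by (simp only:) (intro emeasure_subadditive, auto)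
  also have "\<dots> \<le> (\<Sum>n. emeasure M (?A x y n)) + (\<Sum>n. emeasure M (?A y x n))"
    by (intro add_mono emeasure_subadditive_countably) auto
  finally show ?thesis by (simp add: emeasure_step_eq expected_crossings_def)
qed

lemma superharmonic_expected_energy:
  fixes Z :: "'a \<Rightarrow> real"
  assumes Z0: "\<And>x. 0 \<le> Z x" and Z1: "\<And>x. Z x \<le> 1"
    and super: "\<And>x. (\<integral>\<^sup>+y. Z y \<partial>P x) \<le> Z x" and T: "finite T"
  shows "(\<Sum>t\<in>T. expected_crossings t * ennreal ((Z (fst t) - Z (snd t))\<^sup>2)) \<le> 3"
proof -
  let ?D = "\<lambda>n. edge_pmf P (kernel_power P n x0)"
  let ?F = "\<lambda>t. (Z (fst t) - Z (snd t))\<^sup>2"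
  have F1: "?F t \<le> 1" for t
    using Z0[of "fst t"] Z1[of "fst t"] Z0[of "snd t"] Z1[of "snd t"]
    by (subst abs_square_le_1) auto
  have le: "(\<Sum>t\<in>T. pmf (?D n) t * ?F t) \<le> (\<integral>t. ?F t \<partial>?D n)" for n
  proof -
    have "(\<Sum>t\<in>T. pmf (?D n) t * ?F t) = (\<Sum>t\<in>T. (?F t * indicator T t) * pmf (?D n) t)"
      by (intro sum.cong) auto
    also have "\<dots> = (\<integral>t. ?F t * indicator T t \<partial>?D n)"
      using T by (intro integral_measure_pmf_real[symmetric]) (auto simp: indicator_def split: if_splits)
    also have "\<dots> \<le> (\<integral>t. ?F t \<partial>?D n)"
      using F1 by (intro integral_mono integrable_pmf_bounded[where B = 1]) (auto split: split_indicator)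
    finally show ?thesis .
  qed
  have "(\<Sum>t\<in>T. expected_crossings t * ennreal (?F t)) =
      (\<Sum>t\<in>T. \<Sum>n. ennreal (pmf (?D n) t * ?F t))"
    unfolding expected_crossings_def by (simp add: ennreal_suminf_multc ennreal_mult)
  also have "\<dots> = (\<Sum>n. \<Sum>t\<in>T. ennreal (pmf (?D n) t * ?F t))"
    by (intro suminf_sum[symmetric]) auto
  also have "\<dots> = (\<Sum>n. ennreal (\<Sum>t\<in>T. pmf (?D n) t * ?F t))"
    by (subst sum_ennreal) auto
  also have "\<dots> \<le> 3"
  proof (rule suminf_le_const)
    fix N
    have "(\<Sum>n<N. \<Sum>t\<in>T. pmf (?D n) t * ?F t) \<le> 3"
      using order_trans[OF sum_mono[OF le] superharmonic_energy[OF Z0 Z1 super]] .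
    then have "ennreal (\<Sum>n<N. \<Sum>t\<in>T. pmf (?D n) t * ?F t) \<le> ennreal 3"
      by (rule ennreal_leI)
    then show "(\<Sum>n<N. ennreal (\<Sum>t\<in>T. pmf (?D n) t * ?F t)) \<le> 3"
      by (subst sum_ennreal) (auto intro!: sum_nonneg)
  qed auto
  finally show ?thesis .
qed

text \<open>
  An edge is crossed with at most the probability given by its expected number of crossings in the
  two directions, so each of them contributes one copy of the bound \<open>3\<close>.
\<close>

lemma superharmonic_edge_energy:
  fixes Z :: "'a \<Rightarrow> real"
  assumes Z0: "\<And>x. 0 \<le> Z x" and Z1: "\<And>x. Z x \<le> 1"
    and super: "\<And>x. (\<integral>\<^sup>+y. Z y \<partial>P x) \<le> Z x" and T: "finite T"
    and sym: "prod.swap ` T = T"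
    and p: "\<And>x y. (x, y) \<in> T \<Longrightarrow> p \<le> measure M {\<omega> \<in> space M. crosses_edge X \<omega> {x, y}}"
    and "p \<ge> 0"
  shows "p * (\<Sum>(x, y)\<in>T. (Z x - Z y)\<^sup>2) \<le> 6"
proof -
  let ?F = "\<lambda>t. (Z (fst t) - Z (snd t))\<^sup>2"
  let ?E = "\<lambda>t. expected_crossings t * ennreal (?F t)"
  have "ennreal (p * (\<Sum>t\<in>T. ?F t)) = (\<Sum>t\<in>T. ennreal p * ennreal (?F t))"
    using \<open>p \<ge> 0\<close> by (simp add: sum_distrib_left ennreal_mult sum_ennreal flip: ennreal_mult)
  also have "\<dots> \<le> (\<Sum>t\<in>T. (expected_crossings t + expected_crossings (prod.swap t)) * ennreal (?F t))"
  proof (intro sum_mono mult_right_mono)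
    fix t assume t: "t \<in> T"
    obtain x y where [simp]: "t = (x, y)" by fastforce
    have "ennreal p \<le> emeasure M {\<omega> \<in> space M. crosses_edge X \<omega> {x, y}}"
      using p[of x y] t by (simp add: emeasure_eq_measure ennreal_leI)
    also note emeasure_crosses_edge_le
    finally show "ennreal p \<le> expected_crossings t + expected_crossings (prod.swap t)" by simp
  qed simp
  also have "\<dots> = (\<Sum>t\<in>T. ?E t) + (\<Sum>t\<in>T. ?E (prod.swap t))"
    by (simp add: distrib_right sum.distrib power2_commute)
  also have "(\<Sum>t\<in>T. ?E (prod.swap t)) = (\<Sum>t\<in>prod.swap ` T. ?E t)"
    by (subst sum.reindex) (auto simp: inj_on_def)
  also have "(\<Sum>t\<in>T. ?E t) + (\<Sum>t\<in>prod.swap ` T. ?E t) \<le> 3 + 3"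
    unfolding sym by (intro add_mono superharmonic_expected_energy assms)
  finally have "ennreal (p * (\<Sum>t\<in>T. ?F t)) \<le> ennreal 6" by simp
  then show ?thesis by (subst (asm) ennreal_le_iff) (auto simp: case_prod_beta)
qed

end

section \<open>Dirichlet energy on graphs\<close>

text \<open>
  Energies are sums over ordered pairs: an edge between distinct vertices occurs twice, a loop once
  and with weight zero.
\<close>

definition edge_pairs :: "'a set set \<Rightarrow> ('a \<times> 'a) set" where
  "edge_pairs E = {(x, y). {x, y} \<in> E}"

text \<open>
  The last conjunct bounds the Dirichlet energy, an infinite sum of nonnegative terms, through its
  finite partial sums.
\<close>

definition cutoff :: "'a set \<Rightarrow> 'a set set \<Rightarrow> real \<Rightarrow> 'a set \<Rightarrow> ('a \<Rightarrow> real) \<Rightarrow> bool" where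
  "cutoff V E C W f \<longleftrightarrow> finite {x. f x \<noteq> 0} \<and> {x. f x \<noteq> 0} \<subseteq> V \<and> (\<forall>x\<in>W. f x = 1) \<and>
     (\<forall>T. finite T \<longrightarrow> T \<subseteq> edge_pairs E \<longrightarrow> (\<Sum>(x, y)\<in>T. (f x - f y)\<^sup>2) \<le> C)"

lemma edge_pairs_swap: "(x, y) \<in> edge_pairs E \<longleftrightarrow> (y, x) \<in> edge_pairs E"
  by (simp add: edge_pairs_def insert_commute)

lemma edge_pairs_subset: "ugraph (V, E) \<Longrightarrow> edge_pairs E \<subseteq> V \<times> V"
  by (fastforce simp: ugraph_def edge_pairs_def doubleton_eq_iff)

lemma edge_pairs_touching:
  "edge_pairs E \<inter> (F \<times> UNIV \<union> UNIV \<times> F) =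
   Sigma F (neighbours (V, E)) \<union> prod.swap ` Sigma F (neighbours (V, E))"
  by (auto simp: edge_pairs_def neighbours_def insert_commute image_iff)

text \<open>
  \<open>T\<close> consists of the pairs with an endpoint in \<open>F\<close>, which contain the support of the left-hand
  side. It is invariant under swapping, which exchanges the two halves \<open>f x * (g x - g y)\<close> and
  \<open>- f y * (g x - g y)\<close> of each product.
\<close>

lemma summation_by_parts:
  fixes f g :: "'a \<Rightarrow> real"
  assumes F: "finite F" "{x. f x \<noteq> 0} \<subseteq> F" and N: "\<And>x. x \<in> F \<Longrightarrow> finite (neighbours (V, E) x)"
  defines "T \<equiv> edge_pairs E \<inter> (F \<times> UNIV \<union> UNIV \<times> F)"
  shows "finite T"
    and "(\<Sum>(x, y)\<in>T. (f x - f y) * (g x - g y)) =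
      2 * (\<Sum>x\<in>F. f x * (\<Sum>y\<in>neighbours (V, E) x. g x - g y))"
proof -
  have T: "T = Sigma F (neighbours (V, E)) \<union> prod.swap ` Sigma F (neighbours (V, E))"
    unfolding T_def by (rule edge_pairs_touching)
  have finS: "finite (Sigma F (neighbours (V, E)))" using F(1) N by (intro finite_SigmaI)
  then show fin: "finite T" unfolding T by simp
  have sym: "prod.swap ` T = T" unfolding T by (auto simp: image_Un image_image)
  have "(\<Sum>t\<in>T. f (snd t) * (g (fst t) - g (snd t))) =
      (\<Sum>t\<in>prod.swap ` T. f (snd t) * (g (fst t) - g (snd t)))"
    by (simp only: sym)
  also have "\<dots> = (\<Sum>t\<in>T. f (fst t) * (g (snd t) - g (fst t)))"
    by (subst sum.reindex) (auto simp: inj_on_def)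
  finally have swap: "(\<Sum>t\<in>T. f (snd t) * (g (fst t) - g (snd t))) =
      - (\<Sum>t\<in>T. f (fst t) * (g (fst t) - g (snd t)))"
    by (simp add: sum_negf[symmetric] algebra_simps)
  have "(\<Sum>(x, y)\<in>T. (f x - f y) * (g x - g y)) =
      (\<Sum>t\<in>T. f (fst t) * (g (fst t) - g (snd t))) - (\<Sum>t\<in>T. f (snd t) * (g (fst t) - g (snd t)))"
    by (simp add: case_prod_beta left_diff_distrib sum_subtractf)
  also have "\<dots> = 2 * (\<Sum>t\<in>T. f (fst t) * (g (fst t) - g (snd t)))"
    unfolding swap by simp
  also have "(\<Sum>t\<in>T. f (fst t) * (g (fst t) - g (snd t))) =
      (\<Sum>t\<in>Sigma F (neighbours (V, E)). f (fst t) * (g (fst t) - g (snd t)))"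
  proof (rule sum.mono_neutral_right[OF fin])
    show "Sigma F (neighbours (V, E)) \<subseteq> T" unfolding T by blast
    show "\<forall>t\<in>T - Sigma F (neighbours (V, E)). f (fst t) * (g (fst t) - g (snd t)) = 0"
    proof
      fix t assume t: "t \<in> T - Sigma F (neighbours (V, E))"
      then have "fst t \<notin> F" unfolding T_def edge_pairs_def neighbours_def by auto
      then have "f (fst t) = 0" using F(2) by blast
      then show "f (fst t) * (g (fst t) - g (snd t)) = 0" by simp
    qed
  qed
  also have "\<dots> = (\<Sum>x\<in>F. \<Sum>y\<in>neighbours (V, E) x. f x * (g x - g y))"
    using F(1) N by (subst sum.Sigma) (auto simp: case_prod_beta)
  also have "\<dots> = (\<Sum>x\<in>F. f x * (\<Sum>y\<in>neighbours (V, E) x. g x - g y))"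
    by (simp add: sum_distrib_left)
  finally show "(\<Sum>(x, y)\<in>T. (f x - f y) * (g x - g y)) =
      2 * (\<Sum>x\<in>F. f x * (\<Sum>y\<in>neighbours (V, E) x. g x - g y))" .
qed

lemma small_tail_of_bounded_sums:
  fixes u :: "'b \<Rightarrow> real"
  assumes bd: "\<And>T. finite T \<Longrightarrow> T \<subseteq> S \<Longrightarrow> sum u T \<le> B" and e: "e > 0"
  obtains T0 where "finite T0" "T0 \<subseteq> S"
    "\<And>T. finite T \<Longrightarrow> T \<subseteq> S \<Longrightarrow> T \<inter> T0 = {} \<Longrightarrow> sum u T \<le> e"
proof -
  let ?A = "sum u ` {T. finite T \<and> T \<subseteq> S}"
  have ne: "?A \<noteq> {}" by blast
  have bdd: "bdd_above ?A" using bd by (intro bdd_aboveI[of _ B]) auto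
  have "Sup ?A - e < Sup ?A" using e by simp
  then obtain T0 where T0: "finite T0" "T0 \<subseteq> S" "Sup ?A - e < sum u T0"
    using less_cSup_iff[OF ne bdd] by auto
  have "sum u T \<le> e" if T: "finite T" "T \<subseteq> S" "T \<inter> T0 = {}" for T
  proof -
    have "sum u (T \<union> T0) \<le> Sup ?A"
      using T T0 by (intro cSup_upper bdd imageI) auto
    moreover have "sum u (T \<union> T0) = sum u T + sum u T0"
      using T T0 by (intro sum.union_disjoint) auto
    ultimately show ?thesis using T0(3) by linarith
  qed
  with T0 that show ?thesis by blast
qed

text \<open>
  Choose a finite set \<open>T0\<close> of pairs outside of which \<open>g\<close> has energy at most \<open>e\<close>, and let \<open>W\<close>
  contain \<open>r\<close> and all endpoints of \<open>T0\<close>. A cutoff \<open>f\<close> is constant on the pairs in \<open>T0\<close>, so the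
  energy product of \<open>f\<close> and \<open>g\<close> sees only the tail of \<open>g\<close> and is at most \<open>sqrt (C * e) \<le> 1\<close>. By
  summation by parts it equals \<open>2 * f r = 2\<close>.
\<close>

lemma flow_forbids_cutoffs:
  fixes g :: "'a \<Rightarrow> real"
  assumes r: "r \<in> V" and fin: "\<And>x. x \<in> V \<Longrightarrow> finite (neighbours (V, E) x)"
    and V: "edge_pairs E \<subseteq> V \<times> V"
    and harm: "\<And>x. x \<in> V \<Longrightarrow> (\<Sum>y\<in>neighbours (V, E) x. g x - g y) = indicator {r} x"
    and energy: "\<And>T. finite T \<Longrightarrow> T \<subseteq> edge_pairs E \<Longrightarrow> (\<Sum>(x, y)\<in>T. (g x - g y)\<^sup>2) \<le> B"
  shows "\<exists>W. finite W \<and> W \<subseteq> V \<and> (\<nexists>f. cutoff V E C W f)"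
proof -
  \<comment> \<open>any positive \<open>e\<close> with \<open>C * e < 4\<close> would do\<close>
  define e where "e = 1 / (1 + \<bar>C\<bar>)"
  have "e > 0" by (simp add: e_def add_pos_nonneg)
  then obtain T0 where T0: "finite T0" "T0 \<subseteq> edge_pairs E"
    "\<And>T. finite T \<Longrightarrow> T \<subseteq> edge_pairs E \<Longrightarrow> T \<inter> T0 = {} \<Longrightarrow> (\<Sum>(x, y)\<in>T. (g x - g y)\<^sup>2) \<le> e"
    using small_tail_of_bounded_sums[of "edge_pairs E" "\<lambda>(x, y). (g x - g y)\<^sup>2" B e] energy by metis
  define W where "W = insert r (fst ` T0 \<union> snd ` T0)"
  have "finite W" using T0(1) by (simp add: W_def)
  moreover have "W \<subseteq> V" using T0(2) V r by (force simp: W_def)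
  moreover have "\<not> cutoff V E C W f" for f
  proof
    assume f: "cutoff V E C W f"
    define F where "F = {x. f x \<noteq> 0}"
    define T where "T = edge_pairs E \<inter> (F \<times> UNIV \<union> UNIV \<times> F)"
    have F: "finite F" "F \<subseteq> V" and f1: "\<And>x. x \<in> W \<Longrightarrow> f x = 1"
      using f by (auto simp: cutoff_def F_def)
    have fo: "f r = 1" using f1 by (simp add: W_def)
    then have oF: "r \<in> F" by (simp add: F_def)
    have finF: "finite (neighbours (V, E) x)" if "x \<in> F" for x using that F(2) fin by blast
    have finT: "finite T"
      unfolding T_def by (rule summation_by_parts(1)[OF F(1) _ finF, of f]) (simp_all add: F_def)
    have "(\<Sum>(x, y)\<in>T. (f x - f y) * (g x - g y)) =
        2 * (\<Sum>x\<in>F. f x * (\<Sum>y\<in>neighbours (V, E) x. g x - g y))"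
      unfolding T_def by (rule summation_by_parts(2)[OF F(1) _ finF]) (simp_all add: F_def)
    also have "(\<Sum>x\<in>F. f x * (\<Sum>y\<in>neighbours (V, E) x. g x - g y)) = (\<Sum>x\<in>F. if x = r then 1 else 0)"
      using F(2) harm fo by (intro sum.cong refl) (auto simp: subset_iff)
    also have "\<dots> = 1" using F(1) oF by simp
    finally have two: "(\<Sum>(x, y)\<in>T. (f x - f y) * (g x - g y)) = 2" by simp
    have "(\<Sum>(x, y)\<in>T. (f x - f y) * (g x - g y)) = (\<Sum>(x, y)\<in>T - T0. (f x - f y) * (g x - g y))"
    proof (rule sum.mono_neutral_right[OF finT])
      show "\<forall>t\<in>T - (T - T0). (case t of (x, y) \<Rightarrow> (f x - f y) * (g x - g y)) = 0"
      proof
        fix t assume "t \<in> T - (T - T0)"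
        then have "t \<in> T0" by blast
        then have "f (fst t) = 1" "f (snd t) = 1" by (auto intro!: f1 simp: W_def)
        then show "(case t of (x, y) \<Rightarrow> (f x - f y) * (g x - g y)) = 0" by (simp add: case_prod_beta)
      qed
    qed auto
    then have "2\<^sup>2 = (\<Sum>t\<in>T - T0. (f (fst t) - f (snd t)) * (g (fst t) - g (snd t)))\<^sup>2"
      using two by (simp add: case_prod_beta)
    also have "\<dots> \<le> (\<Sum>t\<in>T - T0. (f (fst t) - f (snd t))\<^sup>2) * (\<Sum>t\<in>T - T0. (g (fst t) - g (snd t))\<^sup>2)"
      by (rule Cauchy_Schwarz_ineq_sum)
    also have "\<dots> \<le> C * e"
    proof (rule mult_mono)
      show "(\<Sum>t\<in>T - T0. (f (fst t) - f (snd t))\<^sup>2) \<le> C"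
        using f finT unfolding cutoff_def by (auto simp: case_prod_beta T_def)
      then show "0 \<le> C" by (rule order_trans[rotated]) (simp add: sum_nonneg)
      show "(\<Sum>t\<in>T - T0. (g (fst t) - g (snd t))\<^sup>2) \<le> e"
        using T0(3)[of "T - T0"] finT by (auto simp: case_prod_beta T_def)
    qed (simp add: sum_nonneg)
    also have "\<dots> \<le> 1"
    proof -
      have "C \<le> 1 + \<bar>C\<bar>" "0 < 1 + \<bar>C\<bar>" by linarith+
      then show ?thesis by (simp add: e_def divide_le_eq_1)
    qed
    finally show False by simp
  qed
  ultimately show ?thesis by blast
qed

section \<open>The unit flow of a transient graph\<close>

text \<open>
  A vertex without neighbours is the only vertex of a connected graph, and then the walk is
  constant.
\<close>

lemma transient_graph_neighbours_nonempty:
  assumes G: "ugraph (V, E)" "connected_graph (V, E)" "srw_transient (V, E)" and x: "x \<in> V"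
  shows "neighbours (V, E) x \<noteq> {}"
proof
  assume empty: "neighbours (V, E) x = {}"
  have "y = x" if "y \<in> V" for y
  proof -
    have "(x, y) \<in> {(u, v). {u, v} \<in> E}\<^sup>*" using G(2) x that by (simp add: connected_graph_def)
    then show ?thesis
      by (cases rule: converse_rtranclE) (use empty in \<open>auto simp: neighbours_def\<close>)
  qed
  then have V: "V = {x}" using x by blast
  from G(3) obtain x0 and N :: "(nat \<Rightarrow> 'a) measure" and Y where x0: "x0 \<in> V"
    and Y: "markov_chain N V (srw_kernel (V, E)) x0 Y" and tr: "transient_chain N x0 Y"
    unfolding srw_transient_def by auto
  interpret markov_chain N V "srw_kernel (V, E)" x0 Y by (rule Y)
  have "Y n \<omega> = x0" if "\<omega> \<in> space N" for n \<omega>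
    using X_in_U[OF that, of n] x0 unfolding V by blast
  then have "AE \<omega> in N. infinite {n. Y n \<omega> = x0}" by (intro AE_I2) simp
  with tr show False by (simp add: recurrent_chain_def)
qed

text \<open>
  Let \<open>p n\<close> be the law of the simple random walk at time \<open>n\<close>, started at \<open>r\<close>, and let
  \<open>g n x = (\<Sum>j<n. p j x) / d x\<close> with the degree \<open>d x\<close>. The walk moves from \<open>y\<close> to \<open>x\<close> with
  probability \<open>1 / d y\<close>, so the Laplacian of \<open>g n\<close> telescopes to \<open>indicator {r} - p n\<close>. As \<open>g n\<close> is
  finitely supported, summation by parts bounds its energy by \<open>2 * g n r\<close>, which stays bounded
  by transience. Bounded energy and connectedness bound \<open>g n\<close> at every vertex, so the increasing
  limit exists, and both the energy bound and the Laplacian pass to the limit.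
\<close>

lemma transient_graph_unit_flow:
  assumes G: "ugraph (V, E)" "connected_graph (V, E)" "locally_finite_graph (V, E)"
    "srw_transient (V, E)"
  obtains r g B where "r \<in> V"
    and "\<And>x. x \<in> V \<Longrightarrow> (\<Sum>y\<in>neighbours (V, E) x. g x - g y) = (indicator {r} x :: real)"
    and "\<And>T. finite T \<Longrightarrow> T \<subseteq> edge_pairs E \<Longrightarrow> (\<Sum>(x, y)\<in>T. (g x - g y)\<^sup>2) \<le> B"
proof -
  let ?K = "srw_kernel (V, E)" and ?N = "neighbours (V, E)"
  from G(4) obtain r and M :: "(nat \<Rightarrow> 'a) measure" and Y where r: "r \<in> V"
    and Y: "markov_chain M V ?K r Y" and tr: "transient_chain M r Y"
    unfolding srw_transient_def by auto
  have green: "green ?K r r < \<top>" by (rule markov_chain.transient_imp_green_finite[OF Y tr])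
  have EV: "edge_pairs E \<subseteq> V \<times> V"
    by (rule edge_pairs_subset[OF G(1)])
  have Nfin: "finite (?N x)" if "x \<in> V" for x
    using G(3) that by (simp add: locally_finite_graph_def)
  have NV: "?N x \<subseteq> V" for x
    using EV by (auto simp: neighbours_def edge_pairs_def)
  have Nsym: "y \<in> ?N x \<longleftrightarrow> x \<in> ?N y" for x y
    by (simp add: neighbours_def insert_commute)
  have Nne: "?N x \<noteq> {}" if "x \<in> V" for x
    by (rule transient_graph_neighbours_nonempty[OF G(1,2,4) that])
  define d where "d x = real (card (?N x))" for x
  have d1: "1 \<le> d x" if "x \<in> V" for x
    using Nfin[OF that] Nne[OF that] by (simp add: d_def Suc_leI card_gt_0_iff)
  have d0: "d x > 0" if "x \<in> V" for x using d1[OF that] by linarith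
  have K: "set_pmf (?K x) = ?N x" if "x \<in> V" for x
    using Nfin[OF that] Nne[OF that] by (simp add: srw_kernel_def)
  have pmfK: "pmf (?K x) y = indicator (?N x) y / d x" if "x \<in> V" for x y
    using Nfin[OF that] Nne[OF that] by (simp add: srw_kernel_def d_def)
  define p where "p n x = pmf (kernel_power ?K n r) x" for n x
  have supp: "set_pmf (kernel_power ?K n r) \<subseteq> V \<and> finite (set_pmf (kernel_power ?K n r))" for n
  proof (induction n)
    case (Suc n)
    then show ?case using K NV Nfin by (auto simp: subset_iff)
  qed (simp add: r)
  have p0: "p 0 x = indicator {r} x" for x by (auto simp: p_def pmf_return split: split_indicator)
  have p_nonneg: "0 \<le> p n x" for n x by (simp add: p_def)
  have p_step: "p (Suc n) x = (\<Sum>y\<in>?N x. p n y / d y)" if x: "x \<in> V" for n x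
  proof -
    have "p (Suc n) x = (\<integral>y. pmf (?K y) x \<partial>kernel_power ?K n r)"
      by (simp add: p_def pmf_bind)
    also have "\<dots> = (\<Sum>y\<in>?N x. pmf (?K y) x * p n y)"
      unfolding p_def
    proof (rule integral_measure_pmf_real[OF Nfin[OF x]])
      fix y assume y: "y \<in> set_pmf (kernel_power ?K n r)" and x: "pmf (?K y) x \<noteq> 0"
      have "y \<in> V" using supp y by blast
      moreover have "x \<in> set_pmf (?K y)" using x by (simp add: set_pmf_iff)
      ultimately show "y \<in> ?N x" using K Nsym by blast
    qed
    also have "\<dots> = (\<Sum>y\<in>?N x. p n y / d y)"
    proof (rule sum.cong[OF refl])
      fix y assume y: "y \<in> ?N x"
      then have "y \<in> V" "x \<in> ?N y" using NV Nsym by auto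
      then show "pmf (?K y) x * p n y = p n y / d y" by (simp add: pmfK)
    qed
    finally show ?thesis .
  qed
  define g where "g n x = (\<Sum>j<n. p j x) / d x" for n x
  have g_nonneg: "0 \<le> g n x" for n x
    by (simp add: g_def d_def sum_nonneg p_nonneg)
  have g_supp: "{x. g n x \<noteq> 0} \<subseteq> (\<Union>j<n. set_pmf (kernel_power ?K j r))" for n
  proof
    fix x assume "x \<in> {x. g n x \<noteq> 0}"
    then have "(\<Sum>j<n. p j x) \<noteq> 0" by (auto simp: g_def)
    then obtain j where "j < n" "p j x \<noteq> 0" by (metis lessThan_iff sum.neutral)
    then show "x \<in> (\<Union>j<n. set_pmf (kernel_power ?K j r))" by (auto simp: p_def set_pmf_iff)
  qed
  have lap: "(\<Sum>y\<in>?N x. g n x - g n y) = indicator {r} x - p n x" if x: "x \<in> V" for n x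
  proof -
    have "(\<Sum>y\<in>?N x. g n x - g n y) = d x * g n x - (\<Sum>y\<in>?N x. g n y)"
      by (simp add: sum_subtractf d_def)
    also have "d x * g n x = (\<Sum>j<n. p j x)" using d0[OF x] by (simp add: g_def)
    also have "(\<Sum>y\<in>?N x. g n y) = (\<Sum>j<n. p (Suc j) x)"
      unfolding g_def p_step[OF x] by (subst sum.swap) (simp add: sum_divide_distrib)
    also have "(\<Sum>j<n. p j x) - (\<Sum>j<n. p (Suc j) x) = (\<Sum>j<n. p j x - p (Suc j) x)"
      by (simp add: sum_subtractf)
    also have "\<dots> = p 0 x - p n x" by (rule sum_lessThan_telescope')
    finally show ?thesis by (simp add: p0)
  qed
  define B where "B = (\<Sum>j. p j r)"
  have g_o: "g n r \<le> B" for n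
  proof -
    have "summable (\<lambda>j. p j r)"
      using green unfolding green_def p_def by (intro summable_suminf_not_top) auto
    then have "(\<Sum>j<n. p j r) \<le> B"
      unfolding B_def by (intro sum_le_suminf) (auto simp: p_nonneg)
    moreover have "(\<Sum>j<n. p j r) / d r \<le> (\<Sum>j<n. p j r)"
      using divide_left_mono[of 1 "d r" "\<Sum>j<n. p j r"] d1[OF r]
      by (simp add: sum_nonneg p_nonneg)
    ultimately show ?thesis unfolding g_def by linarith
  qed
  have energy_n: "(\<Sum>(x, y)\<in>T. (g n x - g n y)\<^sup>2) \<le> 2 * B" if T: "finite T" "T \<subseteq> edge_pairs E" for n T
  proof -
    \<comment> \<open>\<open>r\<close> is included because \<open>g 0\<close> vanishes everywhere\<close>
    define F where "F = insert r {x. g n x \<noteq> 0}"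
    define T' where "T' = edge_pairs E \<inter> (F \<times> UNIV \<union> UNIV \<times> F)"
    have "finite {x. g n x \<noteq> 0}"
      by (rule finite_subset[OF g_supp]) (use supp in blast)
    moreover have "{x. g n x \<noteq> 0} \<subseteq> V"
      by (rule order_trans[OF g_supp]) (use supp in blast)
    ultimately have F: "finite F" "F \<subseteq> V" "{x. g n x \<noteq> 0} \<subseteq> F"
      using r unfolding F_def by blast+
    have FN: "\<And>x. x \<in> F \<Longrightarrow> finite (?N x)" using F(2) Nfin by blast
    have finT': "finite T'"
      unfolding T'_def by (rule summation_by_parts(1)[OF F(1,3) FN])
    have "(\<Sum>(x, y)\<in>T. (g n x - g n y)\<^sup>2) \<le> (\<Sum>(x, y)\<in>T \<union> T'. (g n x - g n y)\<^sup>2)"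
      using T finT' by (intro sum_mono2) auto
    also have "\<dots> = (\<Sum>(x, y)\<in>T'. (g n x - g n y)\<^sup>2)"
    proof (rule sum.mono_neutral_right)
      show "\<forall>t\<in>T \<union> T' - T'. (case t of (x, y) \<Rightarrow> (g n x - g n y)\<^sup>2) = 0"
      proof
        fix t assume "t \<in> T \<union> T' - T'"
        then have "fst t \<notin> F" "snd t \<notin> F" using T(2) by (auto simp: T'_def mem_Times_iff)
        then show "(case t of (x, y) \<Rightarrow> (g n x - g n y)\<^sup>2) = 0"
          by (simp add: F_def case_prod_beta)
      qed
    qed (use T finT' in auto)
    also have "\<dots> = 2 * (\<Sum>x\<in>F. g n x * (\<Sum>y\<in>?N x. g n x - g n y))"
      using summation_by_parts(2)[OF F(1,3) FN, of "g n"] unfolding T'_def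
      by (simp add: power2_eq_square)
    also have "(\<Sum>x\<in>F. g n x * (\<Sum>y\<in>?N x. g n x - g n y)) \<le> (\<Sum>x\<in>F. if x = r then g n r else 0)"
    proof (rule sum_mono)
      fix x assume "x \<in> F"
      then have "x \<in> V" using F(2) by blast
      then show "g n x * (\<Sum>y\<in>?N x. g n x - g n y) \<le> (if x = r then g n r else 0)"
        using g_nonneg[of n x] p_nonneg[of n x]
        by (auto simp: lap algebra_simps)
    qed
    also have "\<dots> = g n r" using F(1) by (simp add: F_def)
    finally show ?thesis using g_o[of n] by linarith
  qed
  have bounded: "\<exists>b. \<forall>n. g n x \<le> b" if x: "x \<in> V" for x
  proof -
    have "(r, x) \<in> {(u, v). {u, v} \<in> E}\<^sup>*" using G(2) x r by (simp add: connected_graph_def)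
    then show ?thesis
    proof (induction rule: rtrancl_induct)
      case base
      then show ?case using g_o by blast
    next
      case (step y z)
      then obtain b where b: "\<And>n. g n y \<le> b" by blast
      have "g n z \<le> b + (1 + 2 * B)" for n
      proof -
        have "(g n y - g n z)\<^sup>2 \<le> 2 * B"
          using energy_n[of "{(y, z)}" n] step(2) by (simp add: edge_pairs_def)
        \<comment> \<open>\<open>2 * t \<le> 1 + t\<^sup>2\<close> bounds the increment along an edge by the energy\<close>
        moreover have "0 \<le> (g n z - g n y - 1)\<^sup>2" by simp
        ultimately have "2 * (g n z - g n y) \<le> 1 + 2 * B"
          by (simp add: power2_eq_square algebra_simps)
        moreover have "0 \<le> B" using g_nonneg[of 0 r] g_o[of 0] by linarith
        moreover note b[of n]
        ultimately show ?thesis by (simp add: algebra_simps)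
      qed
      then show ?case by blast
    qed
  qed
  define h where "h x = lim (\<lambda>n. g n x)" for x
  have lim: "(\<lambda>n. g n x) \<longlonglongrightarrow> h x" if x: "x \<in> V" for x
  proof -
    obtain b where "\<And>n. g n x \<le> b" using bounded[OF x] by blast
    moreover have "incseq (\<lambda>n. g n x)"
      unfolding g_def by (intro incseq_SucI divide_right_mono) (auto simp: p_nonneg d_def)
    ultimately have "convergent (\<lambda>n. g n x)"
      by (metis incseq_convergent convergent_def)
    then show ?thesis unfolding h_def by (rule convergent_LIMSEQ_iff[THEN iffD1])
  qed
  \<comment> \<open>the increments of a convergent sequence tend to zero\<close>
  have p_lim: "(\<lambda>n. p n x) \<longlonglongrightarrow> 0" if x: "x \<in> V" for x
  proof -
    have "(\<lambda>n. d x * (g (Suc n) x - g n x)) \<longlonglongrightarrow> d x * (h x - h x)"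
      by (intro tendsto_intros LIMSEQ_Suc lim x)
    moreover have "d x * (g (Suc n) x - g n x) = p n x" for n
      using d0[OF x] by (simp add: g_def field_simps)
    ultimately show ?thesis by simp
  qed
  show ?thesis
  proof (rule that[of r h "2 * B"])
    show "r \<in> V" by (rule r)
    fix x assume x: "x \<in> V"
    have "(\<lambda>n. \<Sum>y\<in>?N x. g n x - g n y) \<longlonglongrightarrow> (\<Sum>y\<in>?N x. h x - h y)"
      using NV[of x] by (intro tendsto_sum tendsto_diff lim x) auto
    moreover have "(\<lambda>n. \<Sum>y\<in>?N x. g n x - g n y) \<longlonglongrightarrow> indicator {r} x - 0"
      unfolding lap[OF x] by (intro tendsto_diff tendsto_const p_lim x)
    ultimately show "(\<Sum>y\<in>?N x. h x - h y) = indicator {r} x"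
      using LIMSEQ_unique by fastforce
  next
    fix T assume T: "finite T" "T \<subseteq> edge_pairs E"
    have "(\<lambda>n. \<Sum>t\<in>T. (g n (fst t) - g n (snd t))\<^sup>2) \<longlonglongrightarrow> (\<Sum>t\<in>T. (h (fst t) - h (snd t))\<^sup>2)"
      using T(2) EV by (intro tendsto_intros lim) auto
    moreover have "(\<Sum>t\<in>T. (g n (fst t) - g n (snd t))\<^sup>2) \<le> 2 * B" for n
      using energy_n[OF T] by (simp add: case_prod_beta)
    ultimately have "(\<Sum>t\<in>T. (h (fst t) - h (snd t))\<^sup>2) \<le> 2 * B"
      by (intro LIMSEQ_le_const2) blast+
    then show "(\<Sum>(x, y)\<in>T. (h x - h y)\<^sup>2) \<le> 2 * B" by (simp add: case_prod_beta)
  qed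
qed

section \<open>Chains that cover a graph\<close>

context markov_chain
begin

text \<open>
  If the set \<open>S\<close> of these vertices were infinite, then on \<open>A\<close> it would be visited after every time
  \<open>n\<close>, which by the maximal inequality has probability at most \<open>k * E h(X n)\<close>, where
  \<open>h v = green P v x0\<close>; and this tends to \<open>0\<close>.
\<close>

lemma finite_superlevel_of_visited:
  assumes fin: "green P x0 x0 < \<top>"
    and A: "A \<in> sets M" "measure M A > 0"
    and visit: "\<And>\<omega> v. \<omega> \<in> A \<Longrightarrow> v \<in> V \<Longrightarrow> \<exists>n. X n \<omega> = v"
  shows "finite {v \<in> V. 1 \<le> of_nat k * green P v x0}"
proof (rule ccontr)
  let ?S = "{v \<in> V. 1 \<le> of_nat k * green P v x0}"
  assume inf: "infinite ?S"
  let ?h = "\<lambda>v. of_nat k * green P v x0"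
  have super: "(\<integral>\<^sup>+y. ?h y \<partial>P x) \<le> ?h x" for x
    by (subst nn_integral_cmult) (auto intro!: mult_left_mono green_superharmonic)
  have "emeasure M A \<le> of_nat k * (\<integral>\<^sup>+y. green P y x0 \<partial>kernel_power P n x0)" for n
  proof -
    have "A \<subseteq> {\<omega> \<in> space M. \<exists>m\<ge>n. X m \<omega> \<in> ?S}"
    proof
      fix \<omega> assume \<omega>: "\<omega> \<in> A"
      have "infinite (?S - (\<lambda>m. X m \<omega>) ` {..<n})" using inf by simp
      then obtain v where v: "v \<in> ?S" "v \<notin> (\<lambda>m. X m \<omega>) ` {..<n}"
        using infinite_imp_nonempty by blast
      then obtain m where m: "X m \<omega> = v" using visit \<omega> by blast
      with v have "m \<ge> n" by (metis imageI lessThan_iff not_le)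
      then show "\<omega> \<in> {\<omega> \<in> space M. \<exists>m\<ge>n. X m \<omega> \<in> ?S}"
        using v(1) m \<omega> sets.sets_into_space[OF A(1)] by blast
    qed
    then have "emeasure M A \<le> emeasure M {\<omega> \<in> space M. \<exists>m\<ge>n. X m \<omega> \<in> ?S}"
      by (rule emeasure_mono) measurable
    also have "\<dots> \<le> (\<integral>\<^sup>+x. ?h x \<partial>kernel_power P n x0)"
      by (rule emeasure_visit_after_le[OF super]) blast
    finally show ?thesis by (simp add: nn_integral_cmult)
  qed
  moreover have "(\<lambda>n. of_nat k * (\<integral>\<^sup>+y. green P y x0 \<partial>kernel_power P n x0)) \<longlonglongrightarrow> of_nat k * 0"
    by (intro ennreal_tendsto_cmult green_tail fin) (rule of_nat_less_top)
  ultimately have "emeasure M A \<le> of_nat k * 0"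
    by (intro LIMSEQ_le_const) blast+
  then have "emeasure M A = 0" by simp
  then show False using A(2) by (simp add: measure_def)
qed

text \<open>
  The cutoffs are \<open>max 0 (2 * Z - 1)\<close> with \<open>Z = min 1 (k * green P x x0)\<close>. Truncating \<open>Z\<close> at
  height \<open>1 / 2\<close> makes the support finite and multiplies the energy by at most \<open>4\<close>. The number \<open>k\<close>
  depends on the finite set \<open>W\<close>, but the energy bound does not.
\<close>

lemma cutoffs_of_covering_chain:
  assumes irr: "irreducible_kernel U P" and tr: "transient_chain M x0 X"
    and VU: "V \<subseteq> U" and EV: "edge_pairs E \<subseteq> V \<times> V"
    and nonisolated: "\<And>x. x \<in> V \<Longrightarrow> neighbours (V, E) x \<noteq> {}"
    and cover: "measure M {\<omega> \<in> space M. \<forall>e\<in>E. crosses_edge X \<omega> e} > 0"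
  shows "\<exists>C. \<forall>W. finite W \<longrightarrow> W \<subseteq> V \<longrightarrow> (\<exists>f. cutoff V E C W f)"
proof -
  define A where "A = {\<omega> \<in> space M. \<forall>e\<in>E. crosses_edge X \<omega> e}"
  define p where "p = measure M A"
  have p: "p > 0" using cover by (simp add: p_def A_def)
  have A: "A \<in> sets M" using p measure_notin_sets[of A M] by (auto simp: p_def)
  have fin: "green P x0 x0 < \<top>" by (rule transient_imp_green_finite[OF tr])
  have visit: "\<exists>n. X n \<omega> = v" if \<omega>: "\<omega> \<in> A" and v: "v \<in> V" for \<omega> v
  proof -
    obtain y where "{v, y} \<in> E" using nonisolated[OF v] by (auto simp: neighbours_def)
    then have "crosses_edge X \<omega> {v, y}" using \<omega> by (simp add: A_def)
    then obtain n where "{X n \<omega>, X (Suc n) \<omega>} = {v, y}" by (auto simp: crosses_edge_def)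
    then show ?thesis by (auto simp: doubleton_eq_iff)
  qed
  have crossed: "p \<le> measure M {\<omega> \<in> space M. crosses_edge X \<omega> {x, y}}"
    if "(x, y) \<in> edge_pairs E" for x y
    unfolding p_def
    by (rule finite_measure_mono) (use that in \<open>auto simp: A_def edge_pairs_def\<close>)
  have "\<exists>f. cutoff V E (24 / p) W f" if W: "finite W" "W \<subseteq> V" for W
  proof -
    have "\<exists>k. 1 \<le> of_nat k * green P x x0" if "x \<in> W" for x
    proof (cases "green P x x0")
      case (real r)
      have "0 < green P x x0"
        using that W(2) VU initial_state by (intro green_pos[OF irr]) auto
      with real have "0 < r" by simp
      then obtain k where "1 < real k * r" using reals_Archimedean3 by blast
      then have "ennreal 1 \<le> ennreal (real k * r)" by (intro ennreal_leI) simp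
      then show ?thesis using real \<open>0 < r\<close>
        by (intro exI[of _ k]) (simp add: ennreal_mult ennreal_of_nat_eq_real_of_nat)
    qed (auto intro!: exI[of _ 1])
    then obtain \<kappa> where \<kappa>: "\<And>x. x \<in> W \<Longrightarrow> 1 \<le> of_nat (\<kappa> x) * green P x x0" by metis
    define k where "k = Max (insert 0 (\<kappa> ` W))"
    have k: "1 \<le> of_nat k * green P x x0" if "x \<in> W" for x
    proof -
      have "\<kappa> x \<le> k" using W(1) that by (auto simp: k_def intro!: Max_ge)
      then have "of_nat (\<kappa> x) * green P x x0 \<le> of_nat k * green P x x0"
        by (intro mult_right_mono of_nat_mono) auto
      with \<kappa>[OF that] show ?thesis by (rule order_trans)
    qed
    define Z where "Z x = enn2real (min 1 (of_nat k * green P x x0))" for x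
    have Z: "ennreal (Z x) = min 1 (of_nat k * green P x x0)" for x
      unfolding Z_def by (rule ennreal_enn2real) (simp add: min_less_iff_disj)
    have Z0: "0 \<le> Z x" for x by (simp add: Z_def)
    have Z1: "Z x \<le> 1" for x
    proof -
      have "ennreal (Z x) \<le> ennreal 1" unfolding Z by simp
      then show ?thesis by (simp only: ennreal_le_iff zero_le_one)
    qed
    have super: "(\<integral>\<^sup>+y. Z y \<partial>P x) \<le> Z x" for x
      unfolding Z
    proof (rule min.boundedI)
      show "(\<integral>\<^sup>+y. min 1 (of_nat k * green P y x0) \<partial>P x) \<le> 1"
        by (rule order_trans[OF nn_integral_mono[of _ _ "\<lambda>_. 1"]]) auto
      have "(\<integral>\<^sup>+y. min 1 (of_nat k * green P y x0) \<partial>P x) \<le> (\<integral>\<^sup>+y. of_nat k * green P y x0 \<partial>P x)"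
        by (rule nn_integral_mono) simp
      also have "\<dots> \<le> of_nat k * green P x x0"
        by (subst nn_integral_cmult) (auto intro!: mult_left_mono green_superharmonic)
      finally show "(\<integral>\<^sup>+y. min 1 (of_nat k * green P y x0) \<partial>P x) \<le> of_nat k * green P x x0" .
    qed
    define f where "f x = (if x \<in> V then max 0 (2 * Z x - 1) else 0)" for x
    have "{x. f x \<noteq> 0} \<subseteq> {v \<in> V. 1 \<le> of_nat (2 * k) * green P v x0}"
    proof
      fix x assume "x \<in> {x. f x \<noteq> 0}"
      then have x: "x \<in> V" and "1 \<le> 2 * Z x" by (auto simp: f_def split: if_splits)
      then have "ennreal 1 \<le> ennreal (2 * Z x)" by (intro ennreal_leI)
      also have "\<dots> = 2 * ennreal (Z x)" by (simp add: ennreal_mult Z0)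
      also have "\<dots> \<le> 2 * (of_nat k * green P x x0)"
        unfolding Z by (intro mult_left_mono) auto
      also have "\<dots> = of_nat (2 * k) * green P x x0" by (simp add: mult.assoc)
      finally show "x \<in> {v \<in> V. 1 \<le> of_nat (2 * k) * green P v x0}" using x by simp
    qed
    moreover have "finite {v \<in> V. 1 \<le> of_nat (2 * k) * green P v x0}"
      using p visit by (intro finite_superlevel_of_visited[OF fin A]) (auto simp: p_def)
    ultimately have "finite {x. f x \<noteq> 0}" by (rule finite_subset)
    moreover have "{x. f x \<noteq> 0} \<subseteq> V" by (auto simp: f_def)
    moreover have "f x = 1" if "x \<in> W" for x
    proof -
      have "ennreal (Z x) = 1" unfolding Z using k[OF that] by (rule min_absorb1)
      then show ?thesis using that W(2) by (auto simp: f_def)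
    qed
    moreover have "(\<Sum>(x, y)\<in>T. (f x - f y)\<^sup>2) \<le> 24 / p"
      if T: "finite T" "T \<subseteq> edge_pairs E" for T
    proof -
      define T' where "T' = T \<union> prod.swap ` T"
      have T': "finite T'" "T' \<subseteq> edge_pairs E" "prod.swap ` T' = T'"
        using T edge_pairs_swap[of _ _ E] by (auto simp: T'_def image_Un image_image)
      have f_Z: "(f x - f y)\<^sup>2 \<le> 4 * (Z x - Z y)\<^sup>2" if "(x, y) \<in> T'" for x y
      proof -
        have "x \<in> V" "y \<in> V" using that T'(2) EV by auto
        then have "f x = max 0 (2 * Z x - 1)" "f y = max 0 (2 * Z y - 1)" by (simp_all only: f_def if_True)
        then have "\<bar>f x - f y\<bar> \<le> \<bar>2 * (Z x - Z y)\<bar>" by (smt (verit))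
        then have "(f x - f y)\<^sup>2 \<le> (2 * (Z x - Z y))\<^sup>2" by (simp only: abs_le_square_iff)
        then show ?thesis unfolding power_mult_distrib by simp
      qed
      have "(\<Sum>(x, y)\<in>T. (f x - f y)\<^sup>2) \<le> (\<Sum>(x, y)\<in>T'. (f x - f y)\<^sup>2)"
        using T'(1) by (intro sum_mono2) (auto simp: T'_def)
      also have "\<dots> \<le> (\<Sum>(x, y)\<in>T'. 4 * (Z x - Z y)\<^sup>2)"
        using f_Z by (intro sum_mono) auto
      also have "\<dots> = 4 * (\<Sum>(x, y)\<in>T'. (Z x - Z y)\<^sup>2)"
        by (simp add: sum_distrib_left case_prod_beta)
      also have "\<dots> \<le> 4 * (6 / p)"
      proof (rule mult_left_mono)
        have "p * (\<Sum>(x, y)\<in>T'. (Z x - Z y)\<^sup>2) \<le> 6"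
          using T' crossed p by (intro superharmonic_edge_energy[OF Z0 Z1 super]) auto
        then show "(\<Sum>(x, y)\<in>T'. (Z x - Z y)\<^sup>2) \<le> 6 / p"
          using p by (simp add: field_simps)
      qed simp
      finally show ?thesis by simp
    qed
    ultimately have "cutoff V E (24 / p) W f" by (simp add: cutoff_def)
    then show ?thesis by blast
  qed
  then show ?thesis by blast
qed

end

lemma no_transient_chain_covers_transient_graph:
  fixes V :: "'a set" and E :: "'a set set"
  assumes G: "ugraph (V, E)" "connected_graph (V, E)" "locally_finite_graph (V, E)"
      "srw_transient (V, E)"
    and X: "markov_chain M U P x0 X" "irreducible_kernel U P" "transient_chain M x0 X"
    and VU: "V \<subseteq> U"
  shows "measure M {\<omega> \<in> space M. \<forall>e\<in>E. crosses_edge X \<omega> e} = 0"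
proof (rule ccontr)
  assume "measure M {\<omega> \<in> space M. \<forall>e\<in>E. crosses_edge X \<omega> e} \<noteq> 0"
  then have cover: "measure M {\<omega> \<in> space M. \<forall>e\<in>E. crosses_edge X \<omega> e} > 0"
    by (simp add: zero_less_measure_iff)
  have EV: "edge_pairs E \<subseteq> V \<times> V" by (rule edge_pairs_subset[OF G(1)])
  obtain r g B where "r \<in> V"
    and "\<And>x. x \<in> V \<Longrightarrow> (\<Sum>y\<in>neighbours (V, E) x. g x - g y) = (indicator {r} x :: real)"
    and "\<And>T. finite T \<Longrightarrow> T \<subseteq> edge_pairs E \<Longrightarrow> (\<Sum>(x, y)\<in>T. (g x - g y)\<^sup>2) \<le> B"
    using transient_graph_unit_flow[OF G] by blast
  then have "\<exists>W. finite W \<and> W \<subseteq> V \<and> (\<nexists>f. cutoff V E C W f)" for C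
    using G(3) EV by (intro flow_forbids_cutoffs[of r V E g B]) (auto simp: locally_finite_graph_def)
  moreover have "\<exists>C. \<forall>W. finite W \<longrightarrow> W \<subseteq> V \<longrightarrow> (\<exists>f. cutoff V E C W f)"
    by (rule markov_chain.cutoffs_of_covering_chain[OF X VU EV
          transient_graph_neighbours_nonempty[OF G(1,2,4)] cover])
  ultimately show False by blast
qed

theorem theorem2:
  fixes V :: "'a set" and E :: "'a set set"
  assumes "ugraph (V, E)" and "connected_graph (V, E)" and "locally_finite_graph (V, E)"
    and "srw_transient (V, E)"
  shows
    "\<not> (\<exists>(M :: 'm measure) U P x0 X.
         markov_chain M U P x0 X \<and> irreducible_kernel U P \<and> transient_chain M x0 X \<and>
         chain_graph U P = (V, E) \<and>
         measure M {\<omega> \<in> space M. \<forall>e \<in> E. crosses_edge X \<omega> e} > 0)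
     \<and>
     \<not> (\<exists>(M :: 'm measure) U P x0 X.
         markov_chain M U P x0 X \<and> irreducible_kernel U P \<and> transient_chain M x0 X \<and>
         (\<exists>\<pi>. stationary_measure U P \<pi>) \<and>
         subgraph (V, E) (chain_graph U P) \<and>
         measure M {\<omega> \<in> space M. \<forall>e \<in> E. crosses_edge X \<omega> e} > 0)"
proof -
  have null: "measure M {\<omega> \<in> space M. \<forall>e\<in>E. crosses_edge X \<omega> e} = 0"
    if "markov_chain M U P x0 X" "irreducible_kernel U P" "transient_chain M x0 X" "V \<subseteq> U"
    for M :: "'m measure" and U P x0 X
    by (rule no_transient_chain_covers_transient_graph[OF assms that])
  show ?thesis
  proof (intro conjI notI; elim exE conjE)
    fix M :: "'m measure" and U P x0 X
    assume chain: "markov_chain M U P x0 X" "irreducible_kernel U P" "transient_chain M x0 X"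
      and pos: "measure M {\<omega> \<in> space M. \<forall>e \<in> E. crosses_edge X \<omega> e} > 0"
    {
      assume "chain_graph U P = (V, E)"
      then have "V \<subseteq> U" by (simp add: chain_graph_def)
      from null[OF chain this] pos show False by linarith
    next
      assume "subgraph (V, E) (chain_graph U P)"
      then have "V \<subseteq> U" by (simp add: subgraph_def chain_graph_def)
      from null[OF chain this] pos show False by linarith
    }
  qed
qed

end
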